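(* Let $\boldsymbol{\pi}\in\mathbb{R}^n$ be a probability vector with strictly positive entries, let $\hat{\boldsymbol{\pi}}=\boldsymbol{\pi}^{1/2}$ (entrywise square root), and let $$\mathcal{M}_{\boldsymbol{\pi}}=\{S\in\mathbb{R}^{n\times n}: S>0,\ S=S^\top,\ S\hat{\boldsymbol{\pi}}=\hat{\boldsymbol{\pi}}\}$$ be endowed with the Fisher metric. Let $f:\mathcal{M}_{\boldsymbol{\pi}}\to\mathbb{R}$ be a smooth function (with a smooth extension to an open neighbourhood of $\mathcal{M}_{\boldsymbol{\pi}}$ in $\mathbb{R}^{n\times n}$, with respect to which the Euclidean gradient $\operatorname{Grad}f$ and Euclidean Hessian $\operatorname{Hess}f$ are taken). Then for every $S\in\mathcal{M}_{\boldsymbol{\pi}}$ and $\xi_S\in\mathcal{T}_S\mathcal{M}_{\boldsymbol{\pi}}$ the Riemannian Hessian can be obtained from the Euclidean gradient and the Euclidean Hessian by the identity $$\operatorname{hess}f(S)[\xi_S]=\widetilde\Pi_S\big(\mathrm{D}(\operatorname{grad}f(S))[\xi_S]\big)-\frac12\,\widetilde\Pi_S\Big(\big(\widetilde\Pi_S(\operatorname{Grad}f(S)\odot S)\odot\xi_S\big)\oslash S\Big),$$ where $\mathrm{D}(\operatorname{grad}f(S))[\xi_S]$ can be derived as $$\mathrm{D}(\operatorname{grad}f(S))[\xi_S]=\dot\gamma[\xi_S]-\big(\dot{\boldsymbol{\alpha}}[\xi_S]\hat{\boldsymbol{\pi}}^\top+\hat{\boldsymbol{\pi}}\dot{\boldsymbol{\alpha}}[\xi_S]^\top\big)\odot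 S-\big(\boldsymbol{\alpha}\hat{\boldsymbol{\pi}}^\top+\hat{\boldsymbol{\pi}}\boldsymbol{\alpha}^\top\big)\odot\xi_S .$$ Here $\gamma=\operatorname{Grad}f(S)\odot S$, $$\dot\gamma[\xi_S]=\operatorname{Hess}f(S)[\xi_S]\odot S+\operatorname{Grad}f(S)\odot\xi_S,$$ and $\boldsymbol{\alpha},\dot{\boldsymbol{\alpha}}[\xi_S]\in\mathbb{R}^n$ solve, respectively, the nonsingular linear systems $$\mathcal{A}\boldsymbol{\alpha}=\frac{\gamma+\gamma^\top}{2}\hat{\boldsymbol{\pi}},\qquad \mathcal{A}\dot{\boldsymbol{\alpha}}[\xi_S]=\frac{\dot\gamma[\xi_S]+\dot\gamma[\xi_S]^\top}{2}\hat{\boldsymbol{\pi}}-\big(\operatorname{diag}(\xi_SD_{\hat{\boldsymbol{\pi}}}\hat{\boldsymbol{\pi}})+D_{\hat{\boldsymbol{\pi}}}\xi_SD_{\hat{\boldsymbol{\pi}}}\big)\boldsymbol{\alpha},$$ with $\mathcal{A}=\operatorname{diag}(SD_{\hat{\boldsymbol{\pi}}}\hat{\boldsymbol{\pi}})+D_{\hat{\boldsymbol{\pi}}}SD_{\hat{\boldsymbol{\pi}}}$.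
   Context: $\mathcal{S}_n=\{X\in\mathbb{R}^{n\times n}:X=X^\top\}$; $S>0$ means that all entries of $S$ are strictly positive; a probability vector is an entrywise nonnegative vector whose entries sum to $1$. $\odot$ and $\oslash$ are the entrywise (Hadamard) product and division. For a vector $\boldsymbol{v}$, $D_{\boldsymbol{v}}=\operatorname{diag}(\boldsymbol{v})$ is the diagonal matrix with diagonal $\boldsymbol{v}$. $\mathcal{M}_{\boldsymbol{\pi}}$ is an embedded manifold of $\mathcal{S}_n$ with tangent space $\mathcal{T}_S\mathcal{M}_{\boldsymbol{\pi}}=\{\xi\in\mathcal{S}_n:\xi\hat{\boldsymbol{\pi}}=\mathbf{0}\}$. The Fisher metric is $\langle\xi,\eta\rangle_S=\sum_{i,j=1}^n\frac{\xi_{ij}\eta_{ij}}{S_{ij}}$. $\Pi_S:\mathcal{S}_n\to\mathcal{T}_S\mathcal{M}_{\boldsymbol{\pi}}$ is the orthogonal projection with respect to the Fisher metric at $S$; explicitly $\Pi_S(Z)=Z-(\boldsymbol{\beta}\hat{\boldsymbol{\pi}}^\top+\hat{\boldsymbol{\pi}}\boldsymbol{\beta}^\top)\odot S$ with $\boldsymbol{\beta}$ the unique solution of $\mathcal{A}\boldsymbol{\beta}=Z\hat{\boldsymbol{\pi}}$. Moreover $\widetilde\Pi_S(Z)=\Pi_S\big(\tfrac{Z+Z^\top}{2}\big)$ for $Z\in\mathbb{R}^{n\times n}$. $\operatorname{Grad}f(S)\in\mathbb{R}^{n\times n}$ is the Euclidean gradient with respect to the Frobenius inner product on $\mathbb{R}^{n\times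 n}$, and $\operatorname{Hess}f(S)[\xi]$ is the directional derivative of $\operatorname{Grad}f$ at $S$ along $\xi$. The Riemannian gradient $\operatorname{grad}f(S)$ is the unique vector in $\mathcal{T}_S\mathcal{M}_{\boldsymbol{\pi}}$ with $\langle\operatorname{grad}f(S),\eta\rangle_S=\mathrm{D}f(S)[\eta]$ for all $\eta\in\mathcal{T}_S\mathcal{M}_{\boldsymbol{\pi}}$, where $\mathrm{D}f(S)[\eta]$ is the directional derivative of $f$ at $S$ along $\eta$. $\mathrm{D}(\operatorname{grad}f(S))[\xi_S]$ denotes the directional derivative at $S$ along $\xi_S$ of the map $S\mapsto\operatorname{grad}f(S)$. The Riemannian Hessian is $\operatorname{hess}f(S)[\xi_S]=\nabla_{\xi_S}\operatorname{grad}f(S)$, with $\nabla$ the Levi-Civita connection of $\mathcal{M}_{\boldsymbol{\pi}}$ for the Fisher metric.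
   Formalization: The displayed formula for D(grad f(S))[ξ_S] fails when γ̇[ξ_S] is not symmetric (e.g. f(S)=S_12); it is proved with its right side replaced by its symmetric part, and literally when γ̇[ξ_S] is symmetric. *)

theory Defs
  imports "HOL-Analysis.Analysis"
begin

section \<open>Matrices\<close>

definition hadamard :: "real^'n^'m \<Rightarrow> real^'n^'m \<Rightarrow> real^'n^'m"  (infixl "\<odot>" 70)
  where "X \<odot> Y = (\<chi> i j. X $ i $ j * Y $ i $ j)"

definition hadamard_div :: "real^'n^'m \<Rightarrow> real^'n^'m \<Rightarrow> real^'n^'m"  (infixl "\<oslash>" 70)
  where "X \<oslash> Y = (\<chi> i j. X $ i $ j / Y $ i $ j)"

definition diag :: "real^'n \<Rightarrow> real^'n^'n"
  where "diag v = (\<chi> i j. if i = j then v $ i else 0)"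

definition outer :: "real^'m \<Rightarrow> real^'n \<Rightarrow> real^'n^'m"
  where "outer x y = (\<chi> i j. x $ i * y $ j)"

definition sym_part :: "real^'n^'n \<Rightarrow> real^'n^'n"
  where "sym_part Z = (1/2) *\<^sub>R (Z + transpose Z)"


section \<open>Differential calculus in Euclidean spaces\<close>

definition dirderiv :: "('a::real_normed_vector \<Rightarrow> 'b::real_normed_vector) \<Rightarrow> 'a \<Rightarrow> 'a \<Rightarrow> 'b"
  where "dirderiv F x v = vector_derivative (\<lambda>t::real. F (x + t *\<^sub>R v)) (at 0)"

text \<open>
  On an open subset of a finite-dimensional space, \<open>Ck_on k A F\<close> says that \<open>F\<close> is of class
  \<open>C\<^sup>k\<close>: all iterated directional derivatives of order at most \<open>k\<close> exist and are continuous.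
\<close>

primrec Ck_on ::
    "nat \<Rightarrow> 'a::real_normed_vector set \<Rightarrow> ('a \<Rightarrow> 'b::real_normed_vector) \<Rightarrow> bool"
  where
    "Ck_on 0 A F \<longleftrightarrow> continuous_on A F"
  | "Ck_on (Suc k) A F \<longleftrightarrow>
       (\<forall>x\<in>A. F differentiable (at x)) \<and> (\<forall>v. Ck_on k A (\<lambda>x. frechet_derivative F (at x) v))"

definition smooth_on :: "'a::real_normed_vector set \<Rightarrow> ('a \<Rightarrow> 'b::real_normed_vector) \<Rightarrow> bool"
  where "smooth_on A F \<longleftrightarrow> (\<forall>k. Ck_on k A F)"

text \<open>The inner product of type \<^typ>\<open>real^'n^'n\<close> is the Frobenius inner product.\<close>

definition Grad :: "(real^'n^'n \<Rightarrow> real) \<Rightarrow> real^'n^'n \<Rightarrow> real^'n^'n"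
  where "Grad F S = (THE D. GDERIV F S :> D)"

definition Hess :: "(real^'n^'n \<Rightarrow> real) \<Rightarrow> real^'n^'n \<Rightarrow> real^'n^'n \<Rightarrow> real^'n^'n"
  where "Hess F S \<xi> = dirderiv (Grad F) S \<xi>"


section \<open>The manifold and the Fisher metric\<close>

definition probability_vector :: "real^'n \<Rightarrow> bool"
  where "probability_vector p \<longleftrightarrow> (\<forall>i. 0 \<le> p $ i) \<and> (\<Sum>i\<in>UNIV. p $ i) = 1"

definition sqrt_vec :: "real^'n \<Rightarrow> real^'n"
  where "sqrt_vec p = (\<chi> i. sqrt (p $ i))"

definition manifold :: "real^'n \<Rightarrow> (real^'n^'n) set"
  where "manifold p =
    {S. (\<forall>i j. 0 < S $ i $ j) \<and> transpose S = S \<and> S *v sqrt_vec p = sqrt_vec p}"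

text \<open>
  The tangent space is the same subspace at every base point, and the manifold is a relatively
  open subset of an affine space with that direction. Hence for \<open>S\<close> in the manifold and \<open>\<xi>\<close>
  tangent, \<open>S + t\<xi>\<close> stays in the manifold for small \<open>t\<close>, and \<^term>\<open>dirderiv h S \<xi>\<close> depends
  only on the values of \<open>h\<close> on the manifold.
\<close>

definition tangent :: "real^'n \<Rightarrow> (real^'n^'n) set"
  where "tangent p = {\<xi>. transpose \<xi> = \<xi> \<and> \<xi> *v sqrt_vec p = 0}"

definition fisher :: "real^'n^'n \<Rightarrow> real^'n^'n \<Rightarrow> real^'n^'n \<Rightarrow> real"
  where "fisher S \<xi> \<eta> = (\<Sum>i\<in>UNIV. \<Sum>j\<in>UNIV. \<xi> $ i $ j * \<eta> $ i $ j / S $ i $ j)"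

definition proj :: "real^'n \<Rightarrow> real^'n^'n \<Rightarrow> real^'n^'n \<Rightarrow> real^'n^'n"
  where "proj p S Z = (THE P. P \<in> tangent p \<and> (\<forall>\<eta>\<in>tangent p. fisher S (Z - P) \<eta> = 0))"

definition projt :: "real^'n \<Rightarrow> real^'n^'n \<Rightarrow> real^'n^'n \<Rightarrow> real^'n^'n"
  where "projt p S Z = proj p S (sym_part Z)"

definition sys_mat :: "real^'n \<Rightarrow> real^'n^'n \<Rightarrow> real^'n^'n"
  where "sys_mat p S =
    (let D = diag (sqrt_vec p) in diag ((S ** D) *v sqrt_vec p) + D ** S ** D)"


section \<open>Levi-Civita connection, Riemannian gradient and Hessian\<close>

definition smooth_on_manifold ::
    "real^'n \<Rightarrow> (real^'n^'n \<Rightarrow> 'b::real_normed_vector) \<Rightarrow> bool"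
  where "smooth_on_manifold p h \<longleftrightarrow>
    (\<exists>U H. open U \<and> manifold p \<subseteq> U \<and> smooth_on U H \<and> (\<forall>S\<in>manifold p. H S = h S))"

definition vector_field :: "real^'n \<Rightarrow> (real^'n^'n \<Rightarrow> real^'n^'n) \<Rightarrow> bool"
  where "vector_field p V \<longleftrightarrow> smooth_on_manifold p V \<and> (\<forall>S\<in>manifold p. V S \<in> tangent p)"

text \<open>
  A connection maps a point \<open>S\<close>, a tangent vector \<open>u\<close> at \<open>S\<close> and a vector field \<open>V\<close> to the
  tangent vector \<open>\<nabla>\<^sub>u V\<close> at \<open>S\<close>.
\<close>

definition affine_connection ::
    "real^'n \<Rightarrow> (real^'n^'n \<Rightarrow> real^'n^'n \<Rightarrow> (real^'n^'n \<Rightarrow> real^'n^'n) \<Rightarrow> real^'n^'n) \<Rightarrow> bool"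
  where "affine_connection p C \<longleftrightarrow>
    (\<forall>S\<in>manifold p. \<forall>u\<in>tangent p. \<forall>V. vector_field p V \<longrightarrow> C S u V \<in> tangent p) \<and>
    (\<forall>U V. vector_field p U \<longrightarrow> vector_field p V \<longrightarrow>
       smooth_on_manifold p (\<lambda>S. C S (U S) V)) \<and>
    (\<forall>S\<in>manifold p. \<forall>u\<in>tangent p. \<forall>w\<in>tangent p. \<forall>a b V. vector_field p V \<longrightarrow>
       C S (a *\<^sub>R u + b *\<^sub>R w) V = a *\<^sub>R C S u V + b *\<^sub>R C S w V) \<and>
    (\<forall>S\<in>manifold p. \<forall>u\<in>tangent p. \<forall>a b V W. vector_field p V \<longrightarrow> vector_field p W \<longrightarrow>
       C S u (\<lambda>X. a *\<^sub>R V X + b *\<^sub>R W X) = a *\<^sub>R C S u V + b *\<^sub>R C S u W) \<and>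
    (\<forall>S\<in>manifold p. \<forall>u\<in>tangent p. \<forall>(h :: real^'n^'n \<Rightarrow> real) V.
       smooth_on_manifold p h \<longrightarrow> vector_field p V \<longrightarrow>
       C S u (\<lambda>X. h X *\<^sub>R V X) = dirderiv h S u *\<^sub>R V S + h S *\<^sub>R C S u V)"

text \<open>The condition is \<open>[U, V] h = (\<nabla>\<^sub>U V - \<nabla>\<^sub>V U) h\<close> for all smooth functions \<open>h\<close>.\<close>

definition torsion_free ::
    "real^'n \<Rightarrow> (real^'n^'n \<Rightarrow> real^'n^'n \<Rightarrow> (real^'n^'n \<Rightarrow> real^'n^'n) \<Rightarrow> real^'n^'n) \<Rightarrow> bool"
  where "torsion_free p C \<longleftrightarrow>
    (\<forall>U V. \<forall>h :: real^'n^'n \<Rightarrow> real.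
       vector_field p U \<longrightarrow> vector_field p V \<longrightarrow> smooth_on_manifold p h \<longrightarrow>
       (\<forall>S\<in>manifold p.
          dirderiv (\<lambda>X. dirderiv h X (V X)) S (U S) - dirderiv (\<lambda>X. dirderiv h X (U X)) S (V S)
          = dirderiv h S (C S (U S) V - C S (V S) U)))"

definition metric_compatible ::
    "real^'n \<Rightarrow> (real^'n^'n \<Rightarrow> real^'n^'n \<Rightarrow> (real^'n^'n \<Rightarrow> real^'n^'n) \<Rightarrow> real^'n^'n) \<Rightarrow> bool"
  where "metric_compatible p C \<longleftrightarrow>
    (\<forall>V W. vector_field p V \<longrightarrow> vector_field p W \<longrightarrow>
       (\<forall>S\<in>manifold p. \<forall>u\<in>tangent p.
          dirderiv (\<lambda>X. fisher X (V X) (W X)) S u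
          = fisher S (C S u V) (W S) + fisher S (V S) (C S u W)))"

text \<open>
  The three conditions determine the connection only on points of the manifold, tangent vectors
  and vector fields; since its arguments are total, a description operator for a unique object
  would not be adequate, so a choice is made here.
\<close>

definition levi_civita ::
    "real^'n \<Rightarrow> real^'n^'n \<Rightarrow> real^'n^'n \<Rightarrow> (real^'n^'n \<Rightarrow> real^'n^'n) \<Rightarrow> real^'n^'n"
  where "levi_civita p =
    (SOME C. affine_connection p C \<and> torsion_free p C \<and> metric_compatible p C)"

definition rgrad :: "real^'n \<Rightarrow> (real^'n^'n \<Rightarrow> real) \<Rightarrow> real^'n^'n \<Rightarrow> real^'n^'n"
  where "rgrad p f S =
    (THE G. G \<in> tangent p \<and> (\<forall>\<eta>\<in>tangent p. fisher S G \<eta> = dirderiv f S \<eta>))"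

definition rhess :: "real^'n \<Rightarrow> (real^'n^'n \<Rightarrow> real) \<Rightarrow> real^'n^'n \<Rightarrow> real^'n^'n \<Rightarrow> real^'n^'n"
  where "rhess p f S \<xi> = levi_civita p S \<xi> (rgrad p f)"

end

theory Submission
  imports Defs
begin

text \<open>
  Write \<open>q\<close> for the entrywise square root of \<open>p\<close>, \<open>D\<close> for the derivative in the ambient
  matrix space and \<open>\<Pi>\<^sub>S\<close> for the Fisher-orthogonal projection onto the tangent space at \<open>S\<close>,
  preceded by symmetrization.

  On the open set of symmetric matrices with positive entries the Fisher metric has the
  Christoffel term \<open>\<Gamma>\<^sub>S(u, v) = -(1/2) (u \<odot> v) \<oslash> S\<close>, because the derivative of
  \<open>u\<^sub>i\<^sub>j v\<^sub>i\<^sub>j / S\<^sub>i\<^sub>j\<close> in \<open>S\<close> along \<open>w\<close> is \<open>-(u\<^sub>i\<^sub>j v\<^sub>i\<^sub>j w\<^sub>i\<^sub>j / S\<^sub>i\<^sub>j\<^sup>2)\<close>, symmetric in \<open>u, v, w\<close>. The manifold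
  is an open piece of an affine subspace, so its Levi-Civita connection is the tangential part of
  the ambient one:
  \<open>\<nabla>\<^sub>u V = DV[u] - (1/2) \<Pi>\<^sub>S((u \<odot> V(S)) \<oslash> S)\<close>. The connection used in the theorem is an arbitrary
  one that is affine, torsion free and metric, so two facts are needed: this formula defines such
  a connection (\<open>affine_connection_fisher\<close>, \<open>torsion_free_fisher\<close>,
  \<open>metric_compatible_fisher\<close>), and any two such connections agree at points of the manifold, on
  tangent vectors and vector fields (\<open>levi_civita_unique\<close>). Existence requires that
  \<open>\<Pi>\<^sub>S Z(S)\<close> depends smoothly on \<open>S\<close>, which is read off from Cramer's rule.

  The Riemannian gradient is \<open>\<Pi>\<^sub>S(Grad F(S) \<odot> S)\<close> (\<open>rgrad_eq_projt\<close>), since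
  \<open>DF(S)[\<eta>] = Grad F(S) \<bullet> \<eta>\<close> is the Fisher product of \<open>Grad F(S) \<odot> S\<close> with \<open>\<eta>\<close>. Substituting
  it for \<open>V\<close> gives the formula for the Hessian; its first term may be projected because the
  derivative of a tangent field along the manifold is again tangent.

  For the derivative of the gradient, the normal component removed by \<open>\<Pi>\<^sub>S\<close> is
  \<open>(\<alpha> q\<^sup>T + q \<alpha>\<^sup>T) \<odot> S\<close>, where \<open>\<alpha>\<close> solves a linear system whose matrix and right-hand side depend on
  \<open>S\<close>. Differentiating the system along \<open>S + t \<xi>\<close> gives the system for the derivative of \<open>\<alpha>\<close>, and
  the product rule does the rest (\<open>rgrad_derivative\<close>). The matrix \<open>R\<close> of the theorem differs from
  the derivative only in its skew part, which symmetrization in \<open>\<Pi>\<^sub>S\<close> removes.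
\<close>

section \<open>Smooth maps\<close>

text \<open>
  Openness of \<open>A\<close> makes the derivative at each point of \<open>A\<close> depend only on the values on \<open>A\<close>,
  so the induction can pass to derivatives.
\<close>

lemma Ck_on_transform:
  assumes "open A" and "Ck_on k A F" and "\<And>x. x \<in> A \<Longrightarrow> F x = G x"
  shows "Ck_on k A G"
  using assms(2,3)
proof (induction k arbitrary: F G)
  case 0
  then show ?case by (simp cong: continuous_on_cong)
next
  case (Suc k)
  have G: "(G has_derivative frechet_derivative F (at x)) (at x)" if "x \<in> A" for x
    by (rule has_derivative_transform_within_open[of F _ x UNIV A])
      (use Suc.prems that \<open>open A\<close> in \<open>auto simp: frechet_derivative_works\<close>)
  have eq: "frechet_derivative F (at x) = frechet_derivative G (at x)" if "x \<in> A" for x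
    using G[OF that] by (rule frechet_derivative_at)
  have "Ck_on k A (\<lambda>x. frechet_derivative G (at x) v)" for v
    by (rule Suc.IH[of "\<lambda>x. frechet_derivative F (at x) v"]) (use Suc.prems(1) eq in simp_all)
  moreover have "G differentiable (at x)" if "x \<in> A" for x
    using G[OF that] by (rule differentiableI)
  ultimately show ?case by simp
qed

text \<open>
  Lets the closure rules below supply the derivative by a formula, valid on \<open>A\<close> only, in place of
  the globally chosen \<^const>\<open>frechet_derivative\<close>.
\<close>

lemma Ck_on_SucI:
  assumes "open A" and "\<And>x. x \<in> A \<Longrightarrow> (F has_derivative F' x) (at x)"
    and "\<And>v. Ck_on k A (\<lambda>x. F' x v)"
  shows "Ck_on (Suc k) A F"
proof -
  have "F' x = frechet_derivative F (at x)" if "x \<in> A" for x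
    using assms(2)[OF that] by (rule frechet_derivative_at)
  then have "Ck_on k A (\<lambda>x. frechet_derivative F (at x) v)" for v
    by (intro Ck_on_transform[OF assms(1) assms(3)[of v]]) simp
  moreover have "F differentiable (at x)" if "x \<in> A" for x
    using assms(2)[OF that] by (rule differentiableI)
  ultimately show ?thesis by simp
qed

lemma Ck_on_mono:
  assumes "Ck_on k A F" "B \<subseteq> A"
  shows "Ck_on k B F"
  using assms(1)
proof (induction k arbitrary: F)
  case 0
  then show ?case unfolding Ck_on.simps by (rule continuous_on_subset[OF _ assms(2)])
next
  case (Suc k)
  then show ?case using assms(2) by (simp add: subset_iff)
qed

lemma Ck_on_SucD: "Ck_on (Suc k) A F \<Longrightarrow> Ck_on k A F"
proof (induction k arbitrary: F)
  case 0
  then have "\<forall>x\<in>A. F differentiable (at x)" by simp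
  then show ?case
    by (simp add: continuous_at_imp_continuous_on differentiable_imp_continuous_within)
next
  case (Suc k)
  have "F differentiable (at x)" if "x \<in> A" for x
    using Suc.prems that by simp
  moreover have "Ck_on k A (\<lambda>x. frechet_derivative F (at x) v)" for v
    using Suc.prems by (intro Suc.IH) simp
  ultimately show ?case by simp
qed

lemma Ck_on_const: "Ck_on k A (\<lambda>x. c)"
proof (induction k arbitrary: c)
  case 0
  show ?case by simp
next
  case (Suc k)
  then show ?case by simp
qed

lemma Ck_on_add:
  assumes "open A" "Ck_on k A F" "Ck_on k A G"
  shows "Ck_on k A (\<lambda>x. F x + G x)"
  using assms(2,3)
proof (induction k arbitrary: F G)
  case 0
  then show ?case by (auto intro: continuous_on_add)
next
  case (Suc k)
  show ?case
    by (rule Ck_on_SucI[OF \<open>open A\<close>, where F' = "\<lambda>x v. frechet_derivative F (at x) v + frechet_derivative G (at x) v"])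
      (use Suc \<open>open A\<close> in \<open>auto intro!: has_derivative_add simp: frechet_derivative_works\<close>)
qed

lemma Ck_on_bounded_linear:
  assumes "open A" "bounded_linear L" "Ck_on k A F"
  shows "Ck_on k A (\<lambda>x. L (F x))"
  using assms(3)
proof (induction k arbitrary: F)
  case 0
  then show ?case using bounded_linear.continuous_on[OF assms(2)] by auto
next
  case (Suc k)
  show ?case
    by (rule Ck_on_SucI[OF \<open>open A\<close>, where F' = "\<lambda>x v. L (frechet_derivative F (at x) v)"])
      (use Suc \<open>open A\<close> in \<open>auto intro!: bounded_linear.has_derivative[OF assms(2)] simp: frechet_derivative_works\<close>)
qed

text \<open>
  In each term of the product rule one factor is undifferentiated; \<open>Ck_on_SucD\<close> lowers its order to
  the one for which the induction hypothesis is stated.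
\<close>

lemma Ck_on_bounded_bilinear:
  assumes "open A" "bounded_bilinear B" "Ck_on k A F" "Ck_on k A G"
  shows "Ck_on k A (\<lambda>x. B (F x) (G x))"
  using assms(3,4)
proof (induction k arbitrary: F G)
  case 0
  then show ?case using bounded_bilinear.continuous_on[OF assms(2)] by auto
next
  case (Suc k)
  show ?case
  proof (rule Ck_on_SucI[OF \<open>open A\<close>, where F' = "\<lambda>x v. B (F x) (frechet_derivative G (at x) v) + B (frechet_derivative F (at x) v) (G x)"])
    fix x assume "x \<in> A"
    then show "((\<lambda>x. B (F x) (G x)) has_derivative (\<lambda>v. B (F x) (frechet_derivative G (at x) v) + B (frechet_derivative F (at x) v) (G x))) (at x)"
      using Suc.prems by (intro bounded_bilinear.FDERIV[OF assms(2)]) (auto simp: frechet_derivative_works)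
  next
    fix v
    show "Ck_on k A (\<lambda>x. B (F x) (frechet_derivative G (at x) v) + B (frechet_derivative F (at x) v) (G x))"
      using Suc.prems Ck_on_SucD[OF Suc.prems(1)] Ck_on_SucD[OF Suc.prems(2)] 
      by (intro Ck_on_add Suc.IH \<open>open A\<close>) auto
  qed
qed

text \<open>
  The derivative of \<open>1/g\<close> is \<open>-(1/g) g' (1/g)\<close>, a product of \<open>g'\<close> with factors to which
  the induction hypothesis applies.
\<close>

lemma Ck_on_inverse:
  fixes g :: "'a::real_normed_vector \<Rightarrow> real"
  assumes "open A" "Ck_on k A g" and nz: "\<And>x. x \<in> A \<Longrightarrow> g x \<noteq> 0"
  shows "Ck_on k A (\<lambda>x. inverse (g x))"
  using assms(2)
proof (induction k)
  case 0
  then show ?case using nz by (simp add: continuous_on_inverse)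
next
  case (Suc k)
  have inv: "Ck_on k A (\<lambda>x. inverse (g x))"
    using Suc.IH Ck_on_SucD[OF Suc.prems] by blast
  show ?case
  proof (rule Ck_on_SucI[OF \<open>open A\<close>, where F' = "\<lambda>x v. - (inverse (g x) * frechet_derivative g (at x) v * inverse (g x))"])
    fix x assume "x \<in> A"
    then show "((\<lambda>x. inverse (g x)) has_derivative (\<lambda>v. - (inverse (g x) * frechet_derivative g (at x) v * inverse (g x)))) (at x)"
      using Suc.prems nz by (intro Deriv.has_derivative_inverse) (auto simp: frechet_derivative_works)
  next
    fix v
    show "Ck_on k A (\<lambda>x. - (inverse (g x) * frechet_derivative g (at x) v * inverse (g x)))"
      using Suc.prems inv
      by (intro Ck_on_bounded_linear[OF _ bounded_linear_minus[OF bounded_linear_ident]]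
        Ck_on_bounded_bilinear[OF _ bounded_bilinear_mult] \<open>open A\<close>) auto
  qed
qed

lemma smooth_on_mono: "smooth_on A F \<Longrightarrow> B \<subseteq> A \<Longrightarrow> smooth_on B F"
  unfolding smooth_on_def using Ck_on_mono by blast

lemma smooth_on_transform:
  "open A \<Longrightarrow> smooth_on A F \<Longrightarrow> (\<And>x. x \<in> A \<Longrightarrow> F x = G x) \<Longrightarrow> smooth_on A G"
  unfolding smooth_on_def using Ck_on_transform by blast

lemma smooth_on_const: "smooth_on A (\<lambda>x. c)"
  by (simp add: smooth_on_def Ck_on_const)

lemma smooth_on_add: "open A \<Longrightarrow> smooth_on A F \<Longrightarrow> smooth_on A G \<Longrightarrow> smooth_on A (\<lambda>x. F x + G x)"
  by (simp add: smooth_on_def Ck_on_add)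

lemma smooth_on_bounded_linear:
  "open A \<Longrightarrow> bounded_linear L \<Longrightarrow> smooth_on A F \<Longrightarrow> smooth_on A (\<lambda>x. L (F x))"
  by (simp add: smooth_on_def Ck_on_bounded_linear)

lemma smooth_on_bounded_bilinear:
  "open A \<Longrightarrow> bounded_bilinear B \<Longrightarrow> smooth_on A F \<Longrightarrow> smooth_on A G \<Longrightarrow> smooth_on A (\<lambda>x. B (F x) (G x))"
  by (simp add: smooth_on_def Ck_on_bounded_bilinear)

lemma smooth_on_inverse:
  fixes g :: "'a::real_normed_vector \<Rightarrow> real"
  shows "open A \<Longrightarrow> smooth_on A g \<Longrightarrow> (\<And>x. x \<in> A \<Longrightarrow> g x \<noteq> 0) \<Longrightarrow> smooth_on A (\<lambda>x. inverse (g x))"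
  by (simp add: smooth_on_def Ck_on_inverse)

lemmas smooth_on_scaleR = smooth_on_bounded_bilinear[OF _ bounded_bilinear_scaleR]
lemmas smooth_on_mult = smooth_on_bounded_bilinear[OF _ bounded_bilinear_mult]

lemma smooth_on_diff:
  "open A \<Longrightarrow> smooth_on A F \<Longrightarrow> smooth_on A G \<Longrightarrow> smooth_on A (\<lambda>x. F x - G x)"
  using smooth_on_add[of A F "\<lambda>x. - G x"]
    smooth_on_bounded_linear[OF _ bounded_linear_minus[OF bounded_linear_ident], of A G] by simp

lemma smooth_on_divide:
  fixes f g :: "'a::real_normed_vector \<Rightarrow> real"
  shows "open A \<Longrightarrow> smooth_on A f \<Longrightarrow> smooth_on A g \<Longrightarrow> (\<And>x. x \<in> A \<Longrightarrow> g x \<noteq> 0) \<Longrightarrow>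
    smooth_on A (\<lambda>x. f x / g x)"
  unfolding divide_inverse by (intro smooth_on_mult smooth_on_inverse)

lemma smooth_on_sum:
  "open A \<Longrightarrow> (\<And>i. i \<in> I \<Longrightarrow> smooth_on A (F i)) \<Longrightarrow> smooth_on A (\<lambda>x. \<Sum>i\<in>I. F i x)"
  by (induction I rule: infinite_finite_induct) (auto intro: smooth_on_add smooth_on_const)

lemma smooth_on_prod:
  fixes F :: "'i \<Rightarrow> 'a::real_normed_vector \<Rightarrow> real"
  shows "open A \<Longrightarrow> (\<And>i. i \<in> I \<Longrightarrow> smooth_on A (F i)) \<Longrightarrow> smooth_on A (\<lambda>x. \<Prod>i\<in>I. F i x)"
  by (induction I rule: infinite_finite_induct) (auto intro: smooth_on_mult smooth_on_const)

lemma smooth_on_ident: "smooth_on A (\<lambda>x. x)"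
proof -
  have "Ck_on k A (\<lambda>x. x)" for k by (cases k) (auto simp: Ck_on_const continuous_on_id)
  then show ?thesis by (simp add: smooth_on_def)
qed

lemma smooth_on_vec_nth: "open A \<Longrightarrow> smooth_on A F \<Longrightarrow> smooth_on A (\<lambda>x. F x $ i)"
  by (rule smooth_on_bounded_linear[OF _ bounded_linear_vec_nth])

lemma smooth_on_if: "(c \<Longrightarrow> smooth_on A F) \<Longrightarrow> (\<not> c \<Longrightarrow> smooth_on A G) \<Longrightarrow> smooth_on A (\<lambda>x. if c then F x else G x)"
  by (cases c) auto

text \<open>
  Reduces smoothness of vectors and, applied twice, of matrices to smoothness of their entries.
\<close>

lemma smooth_on_vec_lambda:
  fixes F :: "'a::real_normed_vector \<Rightarrow> 'b::euclidean_space ^ 'n"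
  assumes "open A" and comp: "\<And>i. smooth_on A (\<lambda>x. F x $ i)"
  shows "smooth_on A F"
proof -
  have "smooth_on A (\<lambda>x. \<Sum>b\<in>Basis. (F x \<bullet> b) *\<^sub>R b)"
  proof (intro smooth_on_sum smooth_on_scaleR smooth_on_const \<open>open A\<close>)
    fix b :: "'b^'n" assume "b \<in> Basis"
    then obtain i c where b: "b = axis i c" by (auto simp: Basis_vec_def)
    show "smooth_on A (\<lambda>x. F x \<bullet> b)"
      unfolding b inner_axis
      by (rule smooth_on_bounded_linear[OF \<open>open A\<close> bounded_linear_inner_left comp])
  qed
  then show ?thesis by (simp add: euclidean_representation)
qed

text \<open>
  The Leibniz formula makes the determinant a polynomial in the entries.
\<close>

lemma smooth_on_det:
  fixes M :: "'a::real_normed_vector \<Rightarrow> real^'n^'n"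
  assumes "open A" "\<And>i j. smooth_on A (\<lambda>x. M x $ i $ j)"
  shows "smooth_on A (\<lambda>x. det (M x))"
  unfolding det_def
  by (intro smooth_on_sum smooth_on_mult smooth_on_prod smooth_on_const assms)

section \<open>Derivatives of smooth maps\<close>

lemma smooth_on_has_derivative:
  "smooth_on A F \<Longrightarrow> x \<in> A \<Longrightarrow> (F has_derivative frechet_derivative F (at x)) (at x)"
  unfolding smooth_on_def frechet_derivative_works[symmetric] using Ck_on.simps(2)[of 0 A F] by blast

lemma smooth_on_imp_continuous_on: "smooth_on A F \<Longrightarrow> continuous_on A F"
  unfolding smooth_on_def using Ck_on.simps(1)[of A F] by blast

lemma smooth_on_frechet_derivative: "smooth_on A F \<Longrightarrow> smooth_on A (\<lambda>x. frechet_derivative F (at x) v)"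
  unfolding smooth_on_def using Ck_on.simps(2) by blast

lemma linear_Basis_expansion:
  assumes "linear L"
  shows "L w = (\<Sum>b\<in>Basis. (w \<bullet> b) *\<^sub>R L b)"
proof -
  have "L w = L (\<Sum>b\<in>Basis. (w \<bullet> b) *\<^sub>R b)"
    by (simp add: euclidean_representation)
  then show ?thesis
    by (simp add: linear_sum[OF assms] linear_cmul[OF assms])
qed

text \<open>
  The direction may vary: expanding \<open>V\<close> in the standard basis reduces this to derivatives in fixed
  directions.
\<close>

lemma smooth_on_frechet_derivative_field:
  fixes F :: "'a::euclidean_space \<Rightarrow> 'b::real_normed_vector"
  assumes "open A" "smooth_on A F" "smooth_on A V"
  shows "smooth_on A (\<lambda>x. frechet_derivative F (at x) (V x))"
proof (rule smooth_on_transform[OF \<open>open A\<close>])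
  show "smooth_on A (\<lambda>x. \<Sum>b\<in>Basis. (V x \<bullet> b) *\<^sub>R frechet_derivative F (at x) b)"
    by (intro smooth_on_sum smooth_on_scaleR smooth_on_frechet_derivative assms
      smooth_on_bounded_linear[OF _ bounded_linear_inner_left])
next
  fix x assume "x \<in> A"
  then have "linear (frechet_derivative F (at x))"
    by (intro has_derivative_linear[OF smooth_on_has_derivative[OF assms(2)]])
  then show "(\<Sum>b\<in>Basis. (V x \<bullet> b) *\<^sub>R frechet_derivative F (at x) b) = frechet_derivative F (at x) (V x)"
    by (rule linear_Basis_expansion[symmetric])
qed

text \<open>
  The mean value theorem, used once in direction \<open>u\<close> and then once in direction \<open>v\<close>, turns the
  second difference over a parallelogram into a mixed second derivative at one of its points.
\<close>

lemma second_difference_mean_value: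
  fixes F :: "'a::real_normed_vector \<Rightarrow> real"
  assumes F: "smooth_on A F" and h: "0 < h"
    and inA: "\<And>s t. 0 \<le> s \<Longrightarrow> s \<le> h \<Longrightarrow> 0 \<le> t \<Longrightarrow> t \<le> h \<Longrightarrow> x + s *\<^sub>R u + t *\<^sub>R v \<in> A"
  shows "\<exists>s t. 0 < s \<and> s < h \<and> 0 < t \<and> t < h \<and>
    F (x + h *\<^sub>R u + h *\<^sub>R v) - F (x + h *\<^sub>R u) - F (x + h *\<^sub>R v) + F x
    = h * h * frechet_derivative (\<lambda>y. frechet_derivative F (at y) u) (at (x + s *\<^sub>R u + t *\<^sub>R v)) v"
proof -
  define F1 where "F1 y = frechet_derivative F (at y) u" for y
  have F1: "smooth_on A F1" unfolding F1_def by (rule smooth_on_frechet_derivative[OF F])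
  have D: "((\<lambda>s. G (y + s *\<^sub>R w)) has_field_derivative frechet_derivative G (at (y + r *\<^sub>R w)) w) (at r)"
    if G: "smooth_on A G" and "y + r *\<^sub>R w \<in> A" for G :: "'a \<Rightarrow> real" and y w r
  proof -
    have lin: "linear (frechet_derivative G (at (y + r *\<^sub>R w)))"
      using smooth_on_has_derivative[OF G that(2)] has_derivative_linear by blast
    have "((\<lambda>s. G (y + s *\<^sub>R w)) has_derivative (\<lambda>s. frechet_derivative G (at (y + r *\<^sub>R w)) (s *\<^sub>R w))) (at r)"
      by (rule has_derivative_compose[where g = G and f = "\<lambda>s. y + s *\<^sub>R w",
            OF _ smooth_on_has_derivative[OF G that(2)]])
        (auto intro!: derivative_eq_intros)
    then show ?thesis
      by (simp add: has_field_derivative_def linear_cmul[OF lin] mult.commute[of _ "frechet_derivative G _ w"] fun_eq_iff)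
  qed
  \<comment> \<open>the second difference is the increment of \<open>\<phi>\<close> from \<open>0\<close> to \<open>h\<close>\<close>
  define \<phi> where "\<phi> s = F (x + h *\<^sub>R v + s *\<^sub>R u) - F (x + s *\<^sub>R u)" for s
  have D1: "(\<phi> has_field_derivative F1 (x + h *\<^sub>R v + s *\<^sub>R u) - F1 (x + s *\<^sub>R u)) (at s)"
    if "0 \<le> s" "s \<le> h" for s
    unfolding \<phi>_def F1_def using inA[of s h] inA[of s 0] that h
    by (intro DERIV_diff D[OF F]) (auto simp: algebra_simps)
  then obtain s where s: "0 < s" "s < h"
    "\<phi> h - \<phi> 0 = (h - 0) * (F1 (x + h *\<^sub>R v + s *\<^sub>R u) - F1 (x + s *\<^sub>R u))"
    using MVT2[OF h D1] by auto
  have D2: "((\<lambda>t. F1 (x + s *\<^sub>R u + t *\<^sub>R v)) has_field_derivative frechet_derivative F1 (at (x + s *\<^sub>R u + t *\<^sub>R v)) v) (at t)"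
    if "0 \<le> t" "t \<le> h" for t
    using inA[of s t] that s by (intro D[OF F1]) auto
  then obtain t where t: "0 < t" "t < h"
    "F1 (x + s *\<^sub>R u + h *\<^sub>R v) - F1 (x + s *\<^sub>R u + 0 *\<^sub>R v) = (h - 0) * frechet_derivative F1 (at (x + s *\<^sub>R u + t *\<^sub>R v)) v"
    using MVT2[OF h D2] by auto
  have "F (x + h *\<^sub>R u + h *\<^sub>R v) - F (x + h *\<^sub>R u) - F (x + h *\<^sub>R v) + F x = \<phi> h - \<phi> 0"
    by (simp add: \<phi>_def algebra_simps)
  also have "\<dots> = h * (F1 (x + s *\<^sub>R u + h *\<^sub>R v) - F1 (x + s *\<^sub>R u + 0 *\<^sub>R v))"
    using s(3) by (simp add: algebra_simps)
  also have "\<dots> = h * h * frechet_derivative F1 (at (x + s *\<^sub>R u + t *\<^sub>R v)) v"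
    using t(3) by simp
  finally show ?thesis using s t unfolding F1_def by blast
qed

text \<open>
  The second difference over the parallelogram spanned by \<open>h u\<close> and \<open>h v\<close> is symmetric in \<open>u\<close> and
  \<open>v\<close>. By the previous lemma it is \<open>h\<^sup>2\<close> times either mixed derivative at some nearby point, so
  continuity rules out different values at \<open>x\<close>.
\<close>

lemma second_derivative_symmetric:
  fixes F :: "'a::real_normed_vector \<Rightarrow> real"
  assumes "open A" and F: "smooth_on A F" and "x \<in> A"
  shows "frechet_derivative (\<lambda>y. frechet_derivative F (at y) u) (at x) v
       = frechet_derivative (\<lambda>y. frechet_derivative F (at y) v) (at x) u"
proof (rule ccontr)
  define D where "D u v z = frechet_derivative (\<lambda>y. frechet_derivative F (at y) u) (at z) v" for u v z
  assume "\<not> ?thesis"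
  then have e: "\<bar>D u v x - D v u x\<bar> / 2 > 0" (is "?e > 0") by (simp add: D_def)
  have "continuous_on A (D u v)" for u v
    unfolding D_def by (intro smooth_on_imp_continuous_on smooth_on_frechet_derivative F)
  then have cont: "isCont (D u v) x" for u v
    using \<open>open A\<close> \<open>x \<in> A\<close> by (simp add: continuous_on_eq_continuous_at)
  obtain r where r: "r > 0" "ball x r \<subseteq> A"
    using \<open>open A\<close> \<open>x \<in> A\<close> open_contains_ball by blast
  obtain d1 where d1: "d1 > 0" "\<And>z. dist z x < d1 \<Longrightarrow> \<bar>D u v z - D u v x\<bar> < ?e"
    using cont[of u v] e unfolding continuous_at_eps_delta dist_real_def by blast
  obtain d2 where d2: "d2 > 0" "\<And>z. dist z x < d2 \<Longrightarrow> \<bar>D v u z - D v u x\<bar> < ?e"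
    using cont[of v u] e unfolding continuous_at_eps_delta dist_real_def by blast
  define d where "d = min r (min d1 d2)"
  \<comment> \<open>small enough for the whole parallelogram to lie in the ball of radius \<open>d\<close>\<close>
  define h where "h = d / (norm u + norm v + 1)"
  have d: "d > 0" using r d1 d2 by (simp add: d_def)
  have pos: "norm u + norm v + 1 > 0"
    using norm_ge_zero[of u] norm_ge_zero[of v] by linarith
  have h: "h > 0" using d pos by (simp add: h_def)
  have small: "dist (x + s *\<^sub>R u + t *\<^sub>R v) x < d" if "0 \<le> s" "s \<le> h" "0 \<le> t" "t \<le> h" for s t
  proof -
    have "dist (x + s *\<^sub>R u + t *\<^sub>R v) x \<le> norm (s *\<^sub>R u) + norm (t *\<^sub>R v)"
      by (simp add: dist_norm add.assoc norm_triangle_ineq del: norm_scaleR)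
    also have "\<dots> \<le> h * norm u + h * norm v"
      using that by (auto intro!: add_mono mult_right_mono)
    also have "\<dots> < h * (norm u + norm v + 1)" using h by (simp add: algebra_simps)
    also have "\<dots> = d" using pos by (simp add: h_def)
    finally show ?thesis .
  qed
  have inA: "x + s *\<^sub>R u + t *\<^sub>R v \<in> A" if "0 \<le> s" "s \<le> h" "0 \<le> t" "t \<le> h" for s t
    using small[OF that] r by (auto simp: d_def dist_commute)
  obtain s t where 1: "0 < s" "s < h" "0 < t" "t < h"
    "F (x + h *\<^sub>R u + h *\<^sub>R v) - F (x + h *\<^sub>R u) - F (x + h *\<^sub>R v) + F x = h * h * D u v (x + s *\<^sub>R u + t *\<^sub>R v)"
    using second_difference_mean_value[OF F h inA] unfolding D_def by blast
  have "\<exists>s t. 0 < s \<and> s < h \<and> 0 < t \<and> t < h \<and>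
    F (x + h *\<^sub>R v + h *\<^sub>R u) - F (x + h *\<^sub>R v) - F (x + h *\<^sub>R u) + F x = h * h * D v u (x + s *\<^sub>R v + t *\<^sub>R u)"
    unfolding D_def
  proof (rule second_difference_mean_value[OF F h])
    fix s t :: real assume "0 \<le> s" "s \<le> h" "0 \<le> t" "t \<le> h"
    then show "x + s *\<^sub>R v + t *\<^sub>R u \<in> A"
      using inA[of t s] by (simp add: algebra_simps)
  qed
  then obtain s' t' where 2: "0 < s'" "s' < h" "0 < t'" "t' < h"
    "F (x + h *\<^sub>R v + h *\<^sub>R u) - F (x + h *\<^sub>R v) - F (x + h *\<^sub>R u) + F x = h * h * D v u (x + s' *\<^sub>R v + t' *\<^sub>R u)"
    by blast
  have "h * h * D u v (x + s *\<^sub>R u + t *\<^sub>R v) = h * h * D v u (x + s' *\<^sub>R v + t' *\<^sub>R u)"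
    using 1(5) 2(5) by (simp add: algebra_simps)
  then have "D u v (x + s *\<^sub>R u + t *\<^sub>R v) = D v u (x + t' *\<^sub>R u + s' *\<^sub>R v)"
    using h by (simp add: algebra_simps)
  moreover have "\<bar>D u v (x + s *\<^sub>R u + t *\<^sub>R v) - D u v x\<bar> < ?e"
    using 1 small[of s t] by (intro d1) (simp add: d_def)
  moreover have "\<bar>D v u (x + t' *\<^sub>R u + s' *\<^sub>R v) - D v u x\<bar> < ?e"
    using 2 small[of t' s'] by (intro d2) (simp add: d_def)
  moreover have "\<not> (\<bar>z - a\<bar> < \<bar>a - b\<bar> / 2 \<and> \<bar>z - b\<bar> < \<bar>a - b\<bar> / 2)" for a b z :: real
    by (auto simp: abs_if split: if_splits)
  ultimately show False by metis
qed

text \<open>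
  Product rule for \<open>W H\<close>, the derivative of \<open>H\<close> along the field \<open>W\<close>: differentiating once more along
  \<open>u\<close> gives a pure second derivative of \<open>H\<close> plus the derivative of \<open>H\<close> along \<open>DW[u]\<close>. In a
  commutator of two fields only the second kind of term survives.
\<close>

lemma frechet_derivative_along_field:
  fixes H :: "'a::euclidean_space \<Rightarrow> 'b::real_normed_vector"
  assumes "open A" and H: "smooth_on A H" and W: "smooth_on A W" and x: "x \<in> A"
  shows "frechet_derivative (\<lambda>y. frechet_derivative H (at y) (W y)) (at x) u
    = frechet_derivative (\<lambda>y. frechet_derivative H (at y) (W x)) (at x) u
      + frechet_derivative H (at x) (frechet_derivative W (at x) u)"
proof -
  define G where "G b y = frechet_derivative H (at y) b" for b y
  have G: "smooth_on A (G b)" for b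
    unfolding G_def by (rule smooth_on_frechet_derivative[OF H])
  have expand: "(\<Sum>b\<in>Basis. (w \<bullet> b) *\<^sub>R G b y) = frechet_derivative H (at y) w" if "y \<in> A" for w y
    unfolding G_def
    by (rule linear_Basis_expansion[symmetric, OF has_derivative_linear[OF smooth_on_has_derivative[OF H that]]])
  have D: "frechet_derivative (\<lambda>y. frechet_derivative H (at y) (Y y)) (at x) u
      = (\<Sum>b\<in>Basis. (Y x \<bullet> b) *\<^sub>R frechet_derivative (G b) (at x) u
         + (frechet_derivative Y (at x) u \<bullet> b) *\<^sub>R G b x)" if Y: "smooth_on A Y" for Y
  proof -
    let ?D = "\<lambda>u. \<Sum>b\<in>Basis. (Y x \<bullet> b) *\<^sub>R frechet_derivative (G b) (at x) u
         + (frechet_derivative Y (at x) u \<bullet> b) *\<^sub>R G b x"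
    have "((\<lambda>y. \<Sum>b\<in>Basis. (Y y \<bullet> b) *\<^sub>R G b y) has_derivative ?D) (at x)"
      by (intro has_derivative_sum has_derivative_scaleR has_derivative_inner_left
        smooth_on_has_derivative[OF Y x] smooth_on_has_derivative[OF G x])
    then have "((\<lambda>y. frechet_derivative H (at y) (Y y)) has_derivative ?D) (at x)"
      by (rule has_derivative_transform_within_open[OF _ \<open>open A\<close> x]) (simp add: expand)
    then show ?thesis by (simp only: frechet_derivative_at[symmetric])
  qed
  show ?thesis
    unfolding D[OF W] D[OF smooth_on_const]
    by (simp add: sum.distrib expand[OF x])
qed

lemma dirderivI: "((\<lambda>t. F (x + t *\<^sub>R v)) has_vector_derivative D) (at 0) \<Longrightarrow> dirderiv F x v = D"
  unfolding dirderiv_def by (rule vector_derivative_at)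

lemma smooth_on_line_derivative:
  assumes "smooth_on A F" "x \<in> A"
  shows "((\<lambda>t. F (x + t *\<^sub>R v)) has_vector_derivative frechet_derivative F (at x) v) (at 0)"
proof -
  have "(F has_derivative frechet_derivative F (at x)) (at (x + 0 *\<^sub>R v))"
    using smooth_on_has_derivative[OF assms] by simp
  then have "((\<lambda>t. F (x + t *\<^sub>R v)) has_derivative (\<lambda>t. frechet_derivative F (at x) (t *\<^sub>R v))) (at 0)"
    by (rule has_derivative_compose[where g = F and f = "\<lambda>t. x + t *\<^sub>R v", rotated])
      (auto intro!: derivative_eq_intros)
  moreover have "linear (frechet_derivative F (at x))"
    using smooth_on_has_derivative[OF assms] by (rule has_derivative_linear)
  ultimately show ?thesis
    by (simp add: has_vector_derivative_def linear_cmul)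
qed

section \<open>Matrix operations\<close>

lemma sym_part_nth: "sym_part Z $ i $ j = (Z $ i $ j + Z $ j $ i) / 2"
  by (simp add: sym_part_def transpose_def)

lemma linear_sym_part: "linear sym_part"
  by (rule linearI) (simp_all add: vec_eq_iff sym_part_nth field_simps)

lemma sym_part_id: "transpose Z = Z \<Longrightarrow> sym_part Z = Z"
  by (simp add: sym_part_def flip: scaleR_2)

lemma transpose_sym_part: "transpose (sym_part Z) = sym_part Z"
  by (simp add: vec_eq_iff sym_part_nth transpose_def add.commute)

lemma bounded_bilinear_hadamard: "bounded_bilinear (hadamard :: real^'n^'n \<Rightarrow> _)"
  unfolding bilinear_conv_bounded_bilinear[symmetric]
  by (auto simp: bilinear_def hadamard_def vec_eq_iff algebra_simps intro!: linearI)

lemma bounded_bilinear_outer: "bounded_bilinear (outer :: real^'m \<Rightarrow> real^'n \<Rightarrow> _)"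
  unfolding bilinear_conv_bounded_bilinear[symmetric]
  by (auto simp: bilinear_def outer_def vec_eq_iff algebra_simps intro!: linearI)

lemma bounded_bilinear_matrix_vector: "bounded_bilinear ((*v) :: real^'n^'m \<Rightarrow> _)"
  unfolding bilinear_conv_bounded_bilinear[symmetric]
  by (auto simp: bilinear_def matrix_vector_mult_def vec_eq_iff algebra_simps sum.distrib sum_distrib_left
      intro!: linearI)

lemma sys_mat_nth:
  "sys_mat p S $ i $ j = (if i = j then \<Sum>k\<in>UNIV. S $ i $ k * sqrt_vec p $ k * sqrt_vec p $ k else 0)
     + sqrt_vec p $ i * S $ i $ j * sqrt_vec p $ j"
  by (simp add: sys_mat_def Let_def diag_def matrix_matrix_mult_def matrix_vector_mult_def
      if_distrib if_distribR cong: if_cong)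

lemma linear_sys_mat: "linear (sys_mat p)"
  by (rule linearI)
    (auto simp: vec_eq_iff sys_mat_nth algebra_simps sum.distrib sum_distrib_left)

lemma sys_mat_mult_nth:
  "(sys_mat p S *v \<beta>) $ i = \<beta> $ i * (\<Sum>k\<in>UNIV. S $ i $ k * sqrt_vec p $ k * sqrt_vec p $ k)
     + sqrt_vec p $ i * (\<Sum>k\<in>UNIV. S $ i $ k * sqrt_vec p $ k * \<beta> $ k)"
proof -
  let ?d = "\<lambda>i. \<Sum>k\<in>UNIV. S $ i $ k * sqrt_vec p $ k * sqrt_vec p $ k"
  have "sys_mat p S $ i $ j * \<beta> $ j
      = (if i = j then \<beta> $ i * ?d i else 0) + sqrt_vec p $ i * (S $ i $ j * sqrt_vec p $ j * \<beta> $ j)" for j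
    unfolding sys_mat_nth by (simp add: distrib_right)
  then show ?thesis
    by (simp add: matrix_vector_mult_def sum.distrib flip: sum_distrib_left)
qed

section \<open>The Fisher metric\<close>

lemma fisher_add_left: "fisher S (\<xi> + \<zeta>) \<eta> = fisher S \<xi> \<eta> + fisher S \<zeta> \<eta>"
  by (simp add: fisher_def distrib_right add_divide_distrib sum.distrib)

lemma fisher_scaleR_left: "fisher S (c *\<^sub>R \<xi>) \<eta> = c * fisher S \<xi> \<eta>"
  by (simp add: fisher_def sum_distrib_left mult.assoc)

lemma fisher_commute: "fisher S \<xi> \<eta> = fisher S \<eta> \<xi>"
  by (simp add: fisher_def mult.commute)

lemma fisher_diff_left: "fisher S (\<xi> - \<zeta>) \<eta> = fisher S \<xi> \<eta> - fisher S \<zeta> \<eta>"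
  by (simp add: fisher_def left_diff_distrib diff_divide_distrib sum_subtractf)

lemma fisher_eq_0_imp:
  assumes pos: "\<And>i j. 0 < S $ i $ j" and "fisher S \<xi> \<xi> = 0"
  shows "\<xi> = 0"
proof -
  have nn: "0 \<le> \<xi> $ i $ j * \<xi> $ i $ j / S $ i $ j" for i j
    using pos[of i j] by simp
  have "(\<Sum>j\<in>UNIV. \<xi> $ i $ j * \<xi> $ i $ j / S $ i $ j) = 0" for i
    using assms(2) nn unfolding fisher_def
    by (subst (asm) sum_nonneg_eq_0_iff) (auto intro: sum_nonneg)
  then have "\<xi> $ i $ j * \<xi> $ i $ j / S $ i $ j = 0" for i j
    using nn by (subst (asm) sum_nonneg_eq_0_iff) auto
  then show ?thesis
    using pos by (simp add: vec_eq_iff) (metis less_irrefl)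
qed

section \<open>The manifold and smooth maps on it\<close>

lemma manifold_pos: "S \<in> manifold p \<Longrightarrow> 0 < S $ i $ j"
  by (simp add: manifold_def)

lemma symmetric_nth: "transpose S = S \<Longrightarrow> S $ i $ j = S $ j $ i"
  by (metis transpose_def vec_lambda_beta)

lemma manifold_nth_commute: "S \<in> manifold p \<Longrightarrow> S $ i $ j = S $ j $ i"
  by (simp add: manifold_def symmetric_nth)

lemma tangent_nth_commute: "\<xi> \<in> tangent p \<Longrightarrow> \<xi> $ i $ j = \<xi> $ j $ i"
  by (simp add: tangent_def symmetric_nth)

lemma tangent_mult_sum: "\<xi> \<in> tangent p \<Longrightarrow> (\<Sum>j\<in>UNIV. \<xi> $ i $ j * sqrt_vec p $ j) = 0"
  by (simp add: tangent_def matrix_vector_mult_def vec_eq_iff)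

lemma subspace_tangent: "subspace (tangent p)"
  by (auto simp: subspace_def tangent_def vec_eq_iff transpose_def matrix_vector_mult_def
      distrib_right sum.distrib mult.assoc simp flip: sum_distrib_left)

text \<open>
  The equations of the manifold are affine with linear part those of the tangent space, and
  positivity of the entries is an open condition.
\<close>

lemma manifold_line:
  assumes S: "S \<in> manifold p" and \<xi>: "\<xi> \<in> tangent p"
  shows "\<forall>\<^sub>F t in nhds 0. S + t *\<^sub>R \<xi> \<in> manifold p"
proof -
  have "\<forall>\<^sub>F t in nhds 0. 0 < S $ i $ j + t * \<xi> $ i $ j" for i j
  proof (rule order_tendstoD(1))
    show "((\<lambda>t. S $ i $ j + t * \<xi> $ i $ j) \<longlongrightarrow> S $ i $ j + 0 * \<xi> $ i $ j) (nhds 0)"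
      by (intro tendsto_intros filterlim_ident)
    show "0 < S $ i $ j + 0 * \<xi> $ i $ j" using manifold_pos[OF S] by simp
  qed
  then have "\<forall>\<^sub>F t in nhds 0. \<forall>i\<in>UNIV. \<forall>j\<in>UNIV. 0 < S $ i $ j + t * \<xi> $ i $ j"
    by (intro eventually_ball_finite ballI) auto
  then show ?thesis
  proof eventually_elim
    case (elim t)
    have "transpose (S + t *\<^sub>R \<xi>) = S + t *\<^sub>R \<xi>"
      using manifold_nth_commute[OF S] tangent_nth_commute[OF \<xi>]
      by (auto simp: vec_eq_iff transpose_def)
    moreover have "(S + t *\<^sub>R \<xi>) *v sqrt_vec p = sqrt_vec p"
      using S \<xi> by (simp add: manifold_def tangent_def matrix_vector_mult_add_rdistrib scaleR_matrix_vector_assoc[symmetric])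
    ultimately show ?case using elim by (simp add: manifold_def)
  qed
qed

text \<open>
  Derivatives along tangent lines at points of the manifold only see the values on the manifold.
  This is how extensions of functions and fields to open sets are exchanged below.
\<close>

lemma manifold_line_transform:
  assumes "S \<in> manifold p" "\<xi> \<in> tangent p" and eq: "\<And>X. X \<in> manifold p \<Longrightarrow> H X = h X"
    and D: "((\<lambda>t. H (S + t *\<^sub>R \<xi>)) has_vector_derivative D) (at 0)"
  shows "((\<lambda>t. h (S + t *\<^sub>R \<xi>)) has_vector_derivative D) (at 0)"
proof -
  have ev: "\<forall>\<^sub>F t in nhds 0. t \<in> UNIV \<longrightarrow> H (S + t *\<^sub>R \<xi>) = h (S + t *\<^sub>R \<xi>)"
    using manifold_line[OF assms(1,2)] by eventually_elim (simp add: eq)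
  have "H (S + 0 *\<^sub>R \<xi>) = h (S + 0 *\<^sub>R \<xi>)" using eq assms(1) by simp
  from has_vector_derivative_cong_ev[OF ev this] D show ?thesis by blast
qed

lemma extension_line_derivative:
  assumes "smooth_on U H" "manifold p \<subseteq> U" "\<And>X. X \<in> manifold p \<Longrightarrow> H X = h X"
    "S \<in> manifold p" "\<xi> \<in> tangent p"
  shows "((\<lambda>t. h (S + t *\<^sub>R \<xi>)) has_vector_derivative frechet_derivative H (at S) \<xi>) (at 0)"
  using assms by (intro manifold_line_transform[where H = H, OF _ _ _ smooth_on_line_derivative[of U]]) auto

lemma smooth_on_manifoldE:
  assumes "smooth_on_manifold p h"
  obtains U H where "open U" "manifold p \<subseteq> U" "smooth_on U H" "\<And>S. S \<in> manifold p \<Longrightarrow> H S = h S"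
  using assms unfolding smooth_on_manifold_def by blast

lemma smooth_on_manifoldI:
  assumes "open U" "manifold p \<subseteq> U" "smooth_on U H" "\<And>S. S \<in> manifold p \<Longrightarrow> H S = h S"
  shows "smooth_on_manifold p h"
  using assms unfolding smooth_on_manifold_def by blast

lemma smooth_on_manifold_line_derivative:
  assumes "smooth_on_manifold p h" "S \<in> manifold p" "\<xi> \<in> tangent p"
  shows "((\<lambda>t. h (S + t *\<^sub>R \<xi>)) has_vector_derivative dirderiv h S \<xi>) (at 0)"
proof -
  obtain U H where "open U" and H: "manifold p \<subseteq> U" "smooth_on U H" "\<And>X. X \<in> manifold p \<Longrightarrow> H X = h X"
    using assms(1) by (rule smooth_on_manifoldE) blast
  have "((\<lambda>t. h (S + t *\<^sub>R \<xi>)) has_vector_derivative frechet_derivative H (at S) \<xi>) (at 0)"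
    using H assms(2,3) by (intro extension_line_derivative)
  then show ?thesis using dirderivI by metis
qed

lemma smooth_on_manifold_transform:
  assumes "smooth_on_manifold p g" "\<And>S. S \<in> manifold p \<Longrightarrow> g S = h S"
  shows "smooth_on_manifold p h"
  using assms(1)
proof (rule smooth_on_manifoldE)
  fix U H assume "open U" "manifold p \<subseteq> U" "smooth_on U H" "\<And>S. S \<in> manifold p \<Longrightarrow> H S = g S"
  then show ?thesis using assms(2) by (intro smooth_on_manifoldI[of U p H]) auto
qed

lemma smooth_on_manifold_const: "smooth_on_manifold p (\<lambda>S. c)"
  by (rule smooth_on_manifoldI[OF open_UNIV _ smooth_on_const[of _ c]]) auto

lemma smooth_on_manifold_ident: "smooth_on_manifold p (\<lambda>S. S)"
  by (rule smooth_on_manifoldI[OF open_UNIV _ smooth_on_ident]) auto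

text \<open>
  The extensions of the two maps may live on different open sets; their combination extends to the
  intersection.
\<close>

lemma smooth_on_manifold_combine:
  fixes p :: "real^'n"
  assumes "smooth_on_manifold p f" "smooth_on_manifold p g"
    and comb: "\<And>(U :: (real^'n^'n) set) F G. open U \<Longrightarrow> smooth_on U F \<Longrightarrow> smooth_on U G \<Longrightarrow> smooth_on U (\<lambda>S. B (F S) (G S))"
  shows "smooth_on_manifold p (\<lambda>S. B (f S) (g S))"
proof -
  obtain U F where F: "open U" "manifold p \<subseteq> U" "smooth_on U F" "\<And>S. S \<in> manifold p \<Longrightarrow> F S = f S"
    using assms(1) by (rule smooth_on_manifoldE) blast
  obtain W G where G: "open W" "manifold p \<subseteq> W" "smooth_on W G" "\<And>S. S \<in> manifold p \<Longrightarrow> G S = g S"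
    using assms(2) by (rule smooth_on_manifoldE) blast
  show ?thesis
  proof (rule smooth_on_manifoldI)
    show "open (U \<inter> W)" "manifold p \<subseteq> U \<inter> W" using F G by auto
    show "smooth_on (U \<inter> W) (\<lambda>S. B (F S) (G S))"
      by (rule comb[OF _ smooth_on_mono[OF F(3)] smooth_on_mono[OF G(3)]]) (use F(1) G(1) in auto)
    show "B (F S) (G S) = B (f S) (g S)" if "S \<in> manifold p" for S
      using F G that by simp
  qed
qed

lemma smooth_on_manifold_diff:
  "smooth_on_manifold p f \<Longrightarrow> smooth_on_manifold p g \<Longrightarrow> smooth_on_manifold p (\<lambda>S. f S - g S)"
  by (rule smooth_on_manifold_combine[where B = "(-)"]) (auto intro: smooth_on_diff)

lemma smooth_on_manifold_add:
  "smooth_on_manifold p f \<Longrightarrow> smooth_on_manifold p g \<Longrightarrow> smooth_on_manifold p (\<lambda>S. f S + g S)"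
  by (rule smooth_on_manifold_combine[where B = "(+)"]) (auto intro: smooth_on_add)

lemma smooth_on_manifold_bilinear:
  "bounded_bilinear B \<Longrightarrow> smooth_on_manifold p f \<Longrightarrow> smooth_on_manifold p g \<Longrightarrow> smooth_on_manifold p (\<lambda>S. B (f S) (g S))"
  by (rule smooth_on_manifold_combine[where B = B]) (auto intro: smooth_on_bounded_bilinear)

lemma smooth_on_manifold_linear:
  assumes "bounded_linear L" "smooth_on_manifold p f"
  shows "smooth_on_manifold p (\<lambda>S. L (f S))"
  using smooth_on_manifold_combine[OF assms(2,2), of "\<lambda>x _. L x"] smooth_on_bounded_linear[OF _ assms(1)]
  by blast

text \<open>
  The domain of the extension is cut down to the matrices with positive entries, on which the
  division is smooth.
\<close>

lemma smooth_on_manifold_hadamard_div: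
  assumes "smooth_on_manifold p Z"
  shows "smooth_on_manifold p (\<lambda>S. Z S \<oslash> S)"
proof -
  let ?P = "{S :: real^'a^'a. \<forall>i j. S $ i $ j > 0}"
  have "?P = (\<Inter>i. \<Inter>j. {S. 0 < S $ i $ j})" by auto
  also have "open \<dots>"
    by (intro open_INT ballI open_Collect_less continuous_intros) auto
  finally have op: "open ?P" .
  obtain U H where H: "open U" "manifold p \<subseteq> U" "smooth_on U H" "\<And>S. S \<in> manifold p \<Longrightarrow> H S = Z S"
    using assms by (rule smooth_on_manifoldE) blast
  have o: "open (U \<inter> ?P)" using H(1) op by (rule open_Int)
  have sm: "smooth_on (U \<inter> ?P) (\<lambda>S. H S \<oslash> S)"
  proof (intro smooth_on_vec_lambda o)
    fix i j
    show "smooth_on (U \<inter> ?P) (\<lambda>S. (H S \<oslash> S) $ i $ j)"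
      unfolding hadamard_div_def vec_lambda_beta
      by (intro smooth_on_divide smooth_on_vec_nth smooth_on_ident o smooth_on_mono[OF H(3)])
        (auto simp: less_imp_neq[symmetric])
  qed
  show ?thesis
    by (rule smooth_on_manifoldI[OF o _ sm]) (use H manifold_pos in auto)
qed

section \<open>The orthogonal projection\<close>

text \<open>
  The Fisher-normal space at \<open>S\<close>, inside the symmetric matrices, is the set of matrices of this
  form; \<open>\<beta>\<close> is the Lagrange multiplier of the constraint \<open>\<xi> q = 0\<close>.
\<close>

definition normal_part :: "real^'n \<Rightarrow> real^'n^'n \<Rightarrow> real^'n \<Rightarrow> real^'n^'n"
  where "normal_part q S \<beta> = (outer \<beta> q + outer q \<beta>) \<odot> S"

lemma normal_part_nth: "normal_part q S \<beta> $ i $ j = (\<beta> $ i * q $ j + q $ i * \<beta> $ j) * S $ i $ j"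
  by (simp add: normal_part_def hadamard_def outer_def)

text \<open>
  This is where the matrix of the linear systems comes from: it maps a multiplier to the violation
  of the constraint by the corresponding normal matrix.
\<close>

lemma normal_part_mult: "normal_part (sqrt_vec p) S \<beta> *v sqrt_vec p = sys_mat p S *v \<beta>"
proof (subst vec_eq_iff, rule allI)
  fix i
  let ?q = "sqrt_vec p"
  have "(normal_part ?q S \<beta> *v ?q) $ i
      = (\<Sum>j\<in>UNIV. \<beta> $ i * (S $ i $ j * ?q $ j * ?q $ j) + ?q $ i * (S $ i $ j * ?q $ j * \<beta> $ j))"
    unfolding matrix_vector_mult_def vec_lambda_beta normal_part_nth
    by (intro sum.cong refl) (simp add: algebra_simps)
  then show "(normal_part ?q S \<beta> *v ?q) $ i = (sys_mat p S *v \<beta>) $ i"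
    by (simp add: sys_mat_mult_nth sum.distrib flip: sum_distrib_left)
qed

text \<open>
  The factor \<open>S\<close> cancels the denominator of the metric, and what remains is
  \<open>2 \<beta> \<bullet> (\<eta> q)\<close>, which vanishes for tangent \<open>\<eta>\<close>.
\<close>

lemma fisher_normal_part:
  assumes S: "S \<in> manifold p" and \<eta>: "\<eta> \<in> tangent p"
  shows "fisher S (normal_part (sqrt_vec p) S \<beta>) \<eta> = 0"
proof -
  let ?q = "sqrt_vec p"
  have "fisher S (normal_part ?q S \<beta>) \<eta> = (\<Sum>i\<in>UNIV. \<Sum>j\<in>UNIV. (\<beta> $ i * ?q $ j + ?q $ i * \<beta> $ j) * \<eta> $ i $ j)"
    unfolding fisher_def normal_part_nth
    using manifold_pos[OF S] by (intro sum.cong refl) (simp add: less_imp_neq[symmetric])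
  also have "\<dots> = (\<Sum>i\<in>UNIV. \<beta> $ i * (\<Sum>j\<in>UNIV. \<eta> $ i $ j * ?q $ j)) + (\<Sum>i\<in>UNIV. \<Sum>j\<in>UNIV. ?q $ i * \<beta> $ j * \<eta> $ i $ j)"
    by (simp add: sum_distrib_left flip: sum.distrib) (simp add: algebra_simps)
  also have "(\<Sum>i\<in>UNIV. \<Sum>j\<in>UNIV. ?q $ i * \<beta> $ j * \<eta> $ i $ j) = (\<Sum>j\<in>UNIV. \<beta> $ j * (\<Sum>i\<in>UNIV. \<eta> $ j $ i * ?q $ i))"
    by (subst sum.swap) (simp add: sum_distrib_left mult_ac tangent_nth_commute[OF \<eta>])
  finally show ?thesis by (simp add: tangent_mult_sum[OF \<eta>])
qed

lemma transpose_normal_part: "S \<in> manifold p \<Longrightarrow> transpose (normal_part q S \<beta>) = normal_part q S \<beta>"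
  by (simp add: vec_eq_iff normal_part_nth transpose_def manifold_nth_commute mult_ac add.commute)

text \<open>
  If \<open>\<beta>\<close> lies in the kernel, then the normal matrix with multiplier \<open>\<beta>\<close> is also tangent, hence
  orthogonal to itself and zero. Its diagonal \<open>2 \<beta>\<^sub>i q\<^sub>i S\<^sub>i\<^sub>i\<close> then forces \<open>\<beta> = 0\<close>.
\<close>

lemma sys_mat_injective:
  assumes pos: "\<forall>i. 0 < p $ i" and S: "S \<in> manifold p" and "sys_mat p S *v \<beta> = 0"
  shows "\<beta> = 0"
proof -
  let ?N = "normal_part (sqrt_vec p) S \<beta>"
  have "?N \<in> tangent p"
    using assms(3) by (simp add: tangent_def transpose_normal_part[OF S] normal_part_mult)
  then have "?N = 0"
    using fisher_normal_part[OF S] manifold_pos[OF S] fisher_eq_0_imp by blast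
  then have "?N $ i $ i = 0" for i by simp
  then have "2 * \<beta> $ i * sqrt_vec p $ i * S $ i $ i = 0" for i
    by (simp add: normal_part_nth algebra_simps)
  moreover have "sqrt_vec p $ i \<noteq> 0" "S $ i $ i \<noteq> 0" for i
    using pos manifold_pos[OF S, of i i] by (auto simp: sqrt_vec_def less_imp_neq[symmetric])
  ultimately show ?thesis by (simp add: vec_eq_iff)
qed

lemma invertible_sys_mat:
  assumes "\<forall>i. 0 < p $ i" "S \<in> manifold p"
  shows "invertible (sys_mat p S)"
  using sys_mat_injective[OF assms]
  by (simp add: invertible_left_inverse matrix_left_invertible_ker)

text \<open>
  The solution of \<open>A x = b\<close> as a quotient of polynomials in the entries of \<open>A\<close> and \<open>b\<close>, which makes
  its smooth dependence on both evident.
\<close>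

definition cramer_solution :: "real^'n^'n \<Rightarrow> real^'n \<Rightarrow> real^'n"
  where "cramer_solution A b = (\<chi> k. det (\<chi> i j. if j = k then b $ i else A $ i $ j) / det A)"

lemma cramer_solution_iff: "invertible A \<Longrightarrow> A *v x = b \<longleftrightarrow> x = cramer_solution A b"
  unfolding cramer_solution_def by (rule cramer) (simp add: invertible_det_nz)

lemma smooth_on_cramer_solution:
  assumes o: "open U" and A: "smooth_on U A" and b: "smooth_on U b" and nz: "\<And>x. x \<in> U \<Longrightarrow> det (A x) \<noteq> 0"
  shows "smooth_on U (\<lambda>x. cramer_solution (A x) (b x))"
  unfolding cramer_solution_def
proof (intro smooth_on_vec_lambda o, unfold vec_lambda_beta)
  fix i
  show "smooth_on U (\<lambda>x. det (\<chi> ia j. if j = i then b x $ ia else A x $ ia $ j) / det (A x))"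
    by (intro smooth_on_divide smooth_on_det o nz, unfold vec_lambda_beta)
     (auto intro!: smooth_on_if smooth_on_vec_nth o A b)
qed

definition multiplier :: "real^'n \<Rightarrow> real^'n^'n \<Rightarrow> real^'n^'n \<Rightarrow> real^'n"
  where "multiplier p S Z = cramer_solution (sys_mat p S) (sym_part Z *v sqrt_vec p)"

text \<open>
  The extension lives on the open set where the system matrix has nonzero determinant; it contains
  the manifold by \<open>invertible_sys_mat\<close>.
\<close>

lemma smooth_on_manifold_multiplier:
  assumes pos: "\<forall>i. 0 < p $ i" and Z: "smooth_on_manifold p Z"
  shows "smooth_on_manifold p (\<lambda>S. multiplier p S (Z S))"
proof -
  let ?D = "{S. det (sys_mat p S) \<noteq> 0}"
  have lin: "bounded_linear (sys_mat p)" "bounded_linear (sym_part :: real^'a^'a \<Rightarrow> _)"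
    by (simp_all add: linear_sys_mat linear_sym_part flip: linear_conv_bounded_linear)
  have sys: "smooth_on V (sys_mat p)" if "open V" for V
    by (rule smooth_on_bounded_linear[OF that lin(1) smooth_on_ident])
  have "continuous_on UNIV (\<lambda>S. det (sys_mat p S))"
    by (intro smooth_on_imp_continuous_on smooth_on_det smooth_on_vec_nth sys open_UNIV)
  then have op: "open ?D"
    by (intro open_Collect_neq continuous_on_const)
  obtain U H where H: "open U" "manifold p \<subseteq> U" "smooth_on U H" "\<And>S. S \<in> manifold p \<Longrightarrow> H S = Z S"
    using Z by (rule smooth_on_manifoldE) blast
  have o: "open (U \<inter> ?D)" using H(1) op by (rule open_Int)
  have "smooth_on (U \<inter> ?D) H" using H(3) by (rule smooth_on_mono) auto
  then have sm: "smooth_on (U \<inter> ?D) (\<lambda>S. multiplier p S (H S))"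
    unfolding multiplier_def
    by (intro smooth_on_cramer_solution smooth_on_bounded_bilinear[OF _ bounded_bilinear_matrix_vector]
      smooth_on_bounded_linear[OF _ lin(2)] smooth_on_const o sys) auto
  show ?thesis
    by (rule smooth_on_manifoldI[OF o _ sm])
      (use H invertible_sys_mat[OF pos] in \<open>auto simp: invertible_det_nz\<close>)
qed

lemma projt_eqI:
  assumes S: "S \<in> manifold p" and P: "P \<in> tangent p"
    and orth: "\<And>\<eta>. \<eta> \<in> tangent p \<Longrightarrow> fisher S (sym_part Z - P) \<eta> = 0"
  shows "projt p S Z = P"
  unfolding projt_def proj_def
proof (rule the_equality)
  show "P \<in> tangent p \<and> (\<forall>\<eta>\<in>tangent p. fisher S (sym_part Z - P) \<eta> = 0)"
    using P orth by blast
next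
  fix Q assume Q: "Q \<in> tangent p \<and> (\<forall>\<eta>\<in>tangent p. fisher S (sym_part Z - Q) \<eta> = 0)"
  have "Q - P \<in> tangent p" using subspace_tangent Q P by (auto intro: subspace_diff)
  then have "fisher S (sym_part Z - P) (Q - P) = 0" "fisher S (sym_part Z - Q) (Q - P) = 0"
    using Q orth by auto
  then have "fisher S (Q - P) (Q - P) = 0"
    by (simp add: fisher_diff_left)
  then show "Q = P" using fisher_eq_0_imp manifold_pos[OF S] by fastforce
qed

lemma
  assumes S: "S \<in> manifold p" and \<beta>: "sys_mat p S *v \<beta> = sym_part Z *v sqrt_vec p"
  shows projt_eq_minus_normal_part: "projt p S Z = sym_part Z - normal_part (sqrt_vec p) S \<beta>"
    and sym_part_minus_normal_part_tangent: "sym_part Z - normal_part (sqrt_vec p) S \<beta> \<in> tangent p"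
proof -
  let ?N = "normal_part (sqrt_vec p) S \<beta>"
  have "transpose (sym_part Z - ?N) = sym_part Z - ?N"
    using transpose_normal_part[OF S, of "sqrt_vec p" \<beta>] transpose_sym_part[of Z]
    by (simp add: vec_eq_iff transpose_def)
  then show T: "sym_part Z - ?N \<in> tangent p"
    using \<beta> by (simp add: tangent_def normal_part_mult matrix_vector_mult_diff_rdistrib)
  show "projt p S Z = sym_part Z - ?N"
    by (rule projt_eqI[OF S T]) (simp add: fisher_normal_part[OF S])
qed

lemma projt_tangent_id: "S \<in> manifold p \<Longrightarrow> \<xi> \<in> tangent p \<Longrightarrow> projt p S \<xi> = \<xi>"
  by (rule projt_eqI) (auto simp: tangent_def sym_part_id fisher_def)

lemma projt_sym_part: "projt p S (sym_part Z) = projt p S Z"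
  by (simp add: projt_def sym_part_id transpose_sym_part)

text \<open>
  Tangent matrices and base points are symmetric, so the skew part of \<open>Z\<close> is orthogonal to every
  tangent vector.
\<close>

lemma fisher_sym_part:
  assumes S: "S \<in> manifold p" and \<eta>: "\<eta> \<in> tangent p"
  shows "fisher S (sym_part Z) \<eta> = fisher S Z \<eta>"
proof -
  have "fisher S (transpose Z) \<eta> = fisher S Z \<eta>"
    unfolding fisher_def
    by (subst sum.swap) (simp add: transpose_def manifold_nth_commute[OF S] tangent_nth_commute[OF \<eta>])
  then show ?thesis
    by (simp add: sym_part_def fisher_scaleR_left fisher_add_left)
qed

context
  fixes p :: "real^'n"
  assumes pos: "\<forall>i. 0 < p $ i"
begin

lemma sys_mat_multiplier:
  "S \<in> manifold p \<Longrightarrow> sys_mat p S *v multiplier p S Z = sym_part Z *v sqrt_vec p"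
  unfolding multiplier_def by (simp add: cramer_solution_iff[OF invertible_sys_mat[OF pos]])

lemma projt_formula:
  "S \<in> manifold p \<Longrightarrow> projt p S Z = sym_part Z - normal_part (sqrt_vec p) S (multiplier p S Z)"
  by (intro projt_eq_minus_normal_part sys_mat_multiplier)

lemma projt_in_tangent: "S \<in> manifold p \<Longrightarrow> projt p S Z \<in> tangent p"
  unfolding projt_formula by (intro sym_part_minus_normal_part_tangent sys_mat_multiplier)

lemma fisher_projt:
  assumes "S \<in> manifold p" "\<eta> \<in> tangent p"
  shows "fisher S (projt p S Z) \<eta> = fisher S Z \<eta>"
  using assms by (simp add: projt_formula fisher_diff_left fisher_normal_part fisher_sym_part)

lemma linear_projt:
  assumes S: "S \<in> manifold p"
  shows "linear (projt p S)"
proof (rule linearI)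
  note tan = projt_in_tangent[OF S]
  have fsp: "fisher S (sym_part Z - projt p S Z) \<eta> = 0" if "\<eta> \<in> tangent p" for Z \<eta>
    using S that by (simp add: fisher_diff_left fisher_projt fisher_sym_part)
  fix X Y and c :: real
  show "projt p S (X + Y) = projt p S X + projt p S Y"
    using fsp[of _ X] fsp[of _ Y] S
    by (intro projt_eqI subspace_add[OF subspace_tangent] tan)
      (auto simp: linear_add[OF linear_sym_part] fisher_diff_left fisher_add_left)
  show "projt p S (c *\<^sub>R X) = c *\<^sub>R projt p S X"
    using fsp[of _ X] S
    by (intro projt_eqI subspace_scale[OF subspace_tangent] tan)
      (auto simp: linear_cmul[OF linear_sym_part] fisher_diff_left fisher_scaleR_left)
qed

text \<open>
  Makes covariant derivatives of smooth fields, and the Riemannian gradient, smooth.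
\<close>

lemma smooth_on_manifold_projt:
  assumes "smooth_on_manifold p Z"
  shows "smooth_on_manifold p (\<lambda>S. projt p S (Z S))"
proof (rule smooth_on_manifold_transform)
  have "bounded_linear (sym_part :: real^'n^'n \<Rightarrow> _)"
    by (simp add: linear_sym_part flip: linear_conv_bounded_linear)
  then show "smooth_on_manifold p (\<lambda>S. sym_part (Z S) - normal_part (sqrt_vec p) S (multiplier p S (Z S)))"
    unfolding normal_part_def
    by (intro smooth_on_manifold_diff smooth_on_manifold_linear[of sym_part]
      smooth_on_manifold_bilinear[OF bounded_bilinear_hadamard] smooth_on_manifold_add
      smooth_on_manifold_bilinear[OF bounded_bilinear_outer] smooth_on_manifold_const
      smooth_on_manifold_multiplier smooth_on_manifold_ident pos assms)
qed (simp add: projt_formula)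

end

section \<open>Vector fields\<close>

lemma vector_fieldD:
  assumes "vector_field p V"
  shows "smooth_on_manifold p V" "S \<in> manifold p \<Longrightarrow> V S \<in> tangent p"
  using assms by (auto simp: vector_field_def)

lemma vector_field_const: "\<xi> \<in> tangent p \<Longrightarrow> vector_field p (\<lambda>S. \<xi>)"
  by (simp add: vector_field_def smooth_on_manifold_const)

text \<open>
  The tangent space is the same linear space at all points, so each linear equation that defines it
  passes from the values of the field to their derivative.
\<close>

lemma dirderiv_vector_field_tangent:
  assumes V: "vector_field p V" and S: "S \<in> manifold p" and u: "u \<in> tangent p"
  shows "dirderiv V S u \<in> tangent p"
proof -
  \<comment> \<open>used for the two linear maps whose common kernel is the tangent space\<close>
  have zero: "L (dirderiv V S u) = 0"
    if L: "bounded_linear L" and "\<And>\<xi>. \<xi> \<in> tangent p \<Longrightarrow> L \<xi> = 0"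
    for L :: "real^'a^'a \<Rightarrow> 'c::real_normed_vector"
  proof -
    have "((\<lambda>t. L (V (S + t *\<^sub>R u))) has_vector_derivative L (dirderiv V S u)) (at 0)"
      by (rule bounded_linear.has_vector_derivative[OF L
        smooth_on_manifold_line_derivative[OF vector_fieldD(1)[OF V] S u]])
    then have "((\<lambda>t. 0) has_vector_derivative L (dirderiv V S u)) (at 0)"
      by (rule manifold_line_transform[OF S u, where H = "\<lambda>X. L (V X)" and h = "\<lambda>_. 0", rotated])
        (simp add: that vector_fieldD(2)[OF V])
    then show ?thesis
      by (rule vector_derivative_unique_at[OF _ has_vector_derivative_const])
  qed
  have "linear (\<lambda>\<xi>. transpose \<xi> - \<xi> :: real^'a^'a)"
    by (rule linearI) (simp_all add: vec_eq_iff transpose_def algebra_simps)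
  then have "transpose (dirderiv V S u) - dirderiv V S u = 0"
    by (intro zero[of "\<lambda>\<xi>. transpose \<xi> - \<xi>"]) (simp_all add: linear_conv_bounded_linear tangent_def)
  moreover have "dirderiv V S u *v sqrt_vec p = 0"
    by (rule zero[OF bounded_bilinear.bounded_linear_left[OF bounded_bilinear_matrix_vector]])
      (simp add: tangent_def)
  ultimately show ?thesis by (simp add: tangent_def)
qed

lemma extension_dirderiv:
  assumes "smooth_on U H" "manifold p \<subseteq> U" "\<And>X. X \<in> manifold p \<Longrightarrow> H X = h X"
    "S \<in> manifold p" "\<xi> \<in> tangent p"
  shows "dirderiv h S \<xi> = frechet_derivative H (at S) \<xi>"
  by (rule dirderivI[OF extension_line_derivative[OF assms]])

lemma dirderiv_linear_direction:
  assumes h: "smooth_on_manifold p h" and S: "S \<in> manifold p" and u: "u \<in> tangent p" and w: "w \<in> tangent p"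
  shows "dirderiv h S (a *\<^sub>R u + b *\<^sub>R w) = a *\<^sub>R dirderiv h S u + b *\<^sub>R dirderiv h S w"
proof -
  obtain U H where "open U" and H: "manifold p \<subseteq> U" "smooth_on U H" "\<And>S. S \<in> manifold p \<Longrightarrow> H S = h S"
    using h by (rule smooth_on_manifoldE) blast
  have "S \<in> U" using H(1) S by blast
  then have "linear (frechet_derivative H (at S))"
    by (rule has_derivative_linear[OF smooth_on_has_derivative[OF H(2)]])
  moreover have "a *\<^sub>R u + b *\<^sub>R w \<in> tangent p"
    using subspace_tangent u w by (auto intro: subspace_add subspace_scale)
  ultimately show ?thesis
    using extension_dirderiv[OF H(2,1,3) S] u w by (simp add: linear_add linear_cmul)
qed

lemma smooth_on_manifold_dirderiv:
  assumes h: "smooth_on_manifold p h" and V: "vector_field p V"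
  shows "smooth_on_manifold p (\<lambda>S. dirderiv h S (V S))"
proof -
  obtain A H where H: "open A" "manifold p \<subseteq> A" "smooth_on A H" "\<And>S. S \<in> manifold p \<Longrightarrow> H S = h S"
    using h by (rule smooth_on_manifoldE) blast
  obtain B W where W: "open B" "manifold p \<subseteq> B" "smooth_on B W" "\<And>S. S \<in> manifold p \<Longrightarrow> W S = V S"
    using vector_fieldD(1)[OF V] by (rule smooth_on_manifoldE) blast
  have sm: "smooth_on (A \<inter> B) (\<lambda>S. frechet_derivative H (at S) (W S))"
    using H(1) W(1) by (intro smooth_on_frechet_derivative_field open_Int
      smooth_on_mono[OF H(3)] smooth_on_mono[OF W(3)]) auto
  show ?thesis
  proof (rule smooth_on_manifoldI[OF _ _ sm])
    show "frechet_derivative H (at S) (W S) = dirderiv h S (V S)" if S: "S \<in> manifold p" for S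
      using extension_dirderiv[OF H(3,2,4) S vector_fieldD(2)[OF V S]] W(4)[OF S] by simp
  qed (use H(1,2) W(1,2) in auto)
qed

section \<open>The Levi-Civita connection\<close>

text \<open>
  The ambient Levi-Civita connection of the Fisher metric, with Christoffel term
  \<open>-(1/2) (u \<odot> v) \<oslash> S\<close>, followed by projection to the tangent space. The first summand is tangent
  already and is left unprojected.
\<close>

definition fisher_connection ::
  "real^'n \<Rightarrow> real^'n^'n \<Rightarrow> real^'n^'n \<Rightarrow> (real^'n^'n \<Rightarrow> real^'n^'n) \<Rightarrow> real^'n^'n"
  where "fisher_connection p S u V = dirderiv V S u - (1/2) *\<^sub>R projt p S ((u \<odot> V S) \<oslash> S)"

lemma hadamard_quotient_linear:
  "((a *\<^sub>R u + b *\<^sub>R w) \<odot> v) \<oslash> S = a *\<^sub>R ((u \<odot> v) \<oslash> S) + b *\<^sub>R ((w \<odot> v) \<oslash> S)"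
  by (simp add: vec_eq_iff hadamard_def hadamard_div_def add_divide_distrib distrib_right mult.assoc)

lemma hadamard_commute: "u \<odot> v = v \<odot> u"
  by (simp add: vec_eq_iff hadamard_def mult.commute)

lemma affine_connection_fisher:
  assumes pos: "\<forall>i. 0 < p $ i"
  shows "affine_connection p (fisher_connection p)"
  unfolding affine_connection_def
proof (intro conjI ballI allI impI)
  fix S u V assume S: "S \<in> manifold p" and u: "u \<in> tangent p" and V: "vector_field p V"
  show "fisher_connection p S u V \<in> tangent p"
    unfolding fisher_connection_def
    by (intro subspace_diff[OF subspace_tangent] subspace_scale[OF subspace_tangent]
      dirderiv_vector_field_tangent[OF V S u] projt_in_tangent[OF pos S])
next
  fix U V assume U: "vector_field p U" and V: "vector_field p V"
  have "smooth_on_manifold p (\<lambda>S. projt p S ((U S \<odot> V S) \<oslash> S))"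
    by (intro smooth_on_manifold_projt[OF pos] smooth_on_manifold_hadamard_div
      smooth_on_manifold_bilinear[OF bounded_bilinear_hadamard] vector_fieldD U V)
  then show "smooth_on_manifold p (\<lambda>S. fisher_connection p S (U S) V)"
    unfolding fisher_connection_def
    by (intro smooth_on_manifold_diff smooth_on_manifold_dirderiv vector_fieldD(1)[OF V] U
      smooth_on_manifold_linear[OF bounded_linear_scaleR_right])
next
  fix S u w a b V assume S: "S \<in> manifold p" and u: "u \<in> tangent p" "w \<in> tangent p" and V: "vector_field p V"
  show "fisher_connection p S (a *\<^sub>R u + b *\<^sub>R w) V
      = a *\<^sub>R fisher_connection p S u V + b *\<^sub>R fisher_connection p S w V"
    unfolding fisher_connection_def hadamard_quotient_linear
      dirderiv_linear_direction[OF vector_fieldD(1)[OF V] S u]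
    by (simp add: linear_add[OF linear_projt[OF pos S]] linear_cmul[OF linear_projt[OF pos S]] algebra_simps)
next
  fix S u a b V W assume S: "S \<in> manifold p" and u: "u \<in> tangent p" and V: "vector_field p V" and W: "vector_field p W"
  have "dirderiv (\<lambda>X. a *\<^sub>R V X + b *\<^sub>R W X) S u = a *\<^sub>R dirderiv V S u + b *\<^sub>R dirderiv W S u"
    by (intro dirderivI has_vector_derivative_add
      bounded_linear.has_vector_derivative[OF bounded_linear_scaleR_right]
      smooth_on_manifold_line_derivative[OF vector_fieldD(1)[OF V] S u]
      smooth_on_manifold_line_derivative[OF vector_fieldD(1)[OF W] S u])
  then show "fisher_connection p S u (\<lambda>X. a *\<^sub>R V X + b *\<^sub>R W X)
      = a *\<^sub>R fisher_connection p S u V + b *\<^sub>R fisher_connection p S u W"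
    unfolding fisher_connection_def hadamard_commute[of u] hadamard_quotient_linear
    by (simp add: linear_add[OF linear_projt[OF pos S]] linear_cmul[OF linear_projt[OF pos S]] algebra_simps)
next
  fix S u and h :: "real^'a^'a \<Rightarrow> real" and V
  assume S: "S \<in> manifold p" and u: "u \<in> tangent p" and h: "smooth_on_manifold p h" and V: "vector_field p V"
  have "((\<lambda>t. h (S + t *\<^sub>R u) *\<^sub>R V (S + t *\<^sub>R u)) has_vector_derivative
      h (S + 0 *\<^sub>R u) *\<^sub>R dirderiv V S u + dirderiv h S u *\<^sub>R V (S + 0 *\<^sub>R u)) (at 0)"
    by (intro bounded_bilinear.has_vector_derivative[OF bounded_bilinear_scaleR]
      smooth_on_manifold_line_derivative[OF h S u]
      smooth_on_manifold_line_derivative[OF vector_fieldD(1)[OF V] S u])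
  then have "dirderiv (\<lambda>X. h X *\<^sub>R V X) S u = h S *\<^sub>R dirderiv V S u + dirderiv h S u *\<^sub>R V S"
    by (intro dirderivI) simp
  moreover have "(u \<odot> h S *\<^sub>R V S) \<oslash> S = h S *\<^sub>R ((u \<odot> V S) \<oslash> S)"
    by (simp add: vec_eq_iff hadamard_def hadamard_div_def)
  ultimately show "fisher_connection p S u (\<lambda>X. h X *\<^sub>R V X) = dirderiv h S u *\<^sub>R V S + h S *\<^sub>R fisher_connection p S u V"
    unfolding fisher_connection_def
    by (simp add: linear_cmul[OF linear_projt[OF pos S]] algebra_simps)
qed

text \<open>
  The Christoffel term is symmetric, so it cancels. The rest says that the commutator of two fields
  is the vector field \<open>DV[U] - DU[V]\<close>, which is symmetry of the second derivative of \<open>h\<close>.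
\<close>

lemma torsion_free_fisher: "torsion_free p (fisher_connection p)"
  unfolding torsion_free_def
proof (intro allI impI ballI)
  fix U V and h :: "real^'a^'a \<Rightarrow> real" and S
  assume U: "vector_field p U" and V: "vector_field p V" and h: "smooth_on_manifold p h" and S: "S \<in> manifold p"
  obtain A H where H: "open A" "manifold p \<subseteq> A" "smooth_on A H" "\<And>S. S \<in> manifold p \<Longrightarrow> H S = h S"
    using h by (rule smooth_on_manifoldE) blast
  have hH: "dirderiv h X w = frechet_derivative H (at X) w" if "X \<in> manifold p" "w \<in> tangent p" for X w
    using extension_dirderiv[OF H(3,2,4) that] by simp
  have key: "dirderiv (\<lambda>X. dirderiv h X (W X)) S w
      = frechet_derivative (\<lambda>y. frechet_derivative H (at y) (W S)) (at S) w + dirderiv h S (dirderiv W S w)"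
    if W: "vector_field p W" and w: "w \<in> tangent p" for W w
  proof -
    obtain B G where G: "open B" "manifold p \<subseteq> B" "smooth_on B G" "\<And>S. S \<in> manifold p \<Longrightarrow> G S = W S"
      using vector_fieldD(1)[OF W] by (rule smooth_on_manifoldE) blast
    have o: "open (A \<inter> B)" and sub: "manifold p \<subseteq> A \<inter> B" using H(1,2) G(1,2) by auto
    have sm: "smooth_on (A \<inter> B) H" "smooth_on (A \<inter> B) G"
      by (auto intro: smooth_on_mono[OF H(3)] smooth_on_mono[OF G(3)])
    have "dirderiv (\<lambda>X. dirderiv h X (W X)) S w = frechet_derivative (\<lambda>y. frechet_derivative H (at y) (G y)) (at S) w"
      by (rule extension_dirderiv[OF smooth_on_frechet_derivative_field[OF o sm] sub _ S w])
        (simp add: G(4) hH vector_fieldD(2)[OF W])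
    also have "\<dots> = frechet_derivative (\<lambda>y. frechet_derivative H (at y) (G S)) (at S) w
        + frechet_derivative H (at S) (frechet_derivative G (at S) w)"
      using S sub by (intro frechet_derivative_along_field[OF o sm]) auto
    also have "frechet_derivative G (at S) w = dirderiv W S w"
      using extension_dirderiv[OF G(3,2,4) S w] by simp
    also have "frechet_derivative H (at S) (dirderiv W S w) = dirderiv h S (dirderiv W S w)"
      by (rule hH[OF S dirderiv_vector_field_tangent[OF W S w], symmetric])
    finally show ?thesis by (simp add: G(4)[OF S])
  qed
  have T: "dirderiv V S (U S) \<in> tangent p" "dirderiv U S (V S) \<in> tangent p"
    using dirderiv_vector_field_tangent[OF V S] dirderiv_vector_field_tangent[OF U S]
      vector_fieldD(2)[OF U S] vector_fieldD(2)[OF V S] by auto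
  have "frechet_derivative (\<lambda>y. frechet_derivative H (at y) (V S)) (at S) (U S)
      = frechet_derivative (\<lambda>y. frechet_derivative H (at y) (U S)) (at S) (V S)"
    using H(2) S by (intro second_derivative_symmetric[OF H(1,3)]) auto
  then have "dirderiv (\<lambda>X. dirderiv h X (V X)) S (U S) - dirderiv (\<lambda>X. dirderiv h X (U X)) S (V S)
      = dirderiv h S (dirderiv V S (U S)) - dirderiv h S (dirderiv U S (V S))"
    using key[OF V vector_fieldD(2)[OF U S]] key[OF U vector_fieldD(2)[OF V S]] by simp
  also have "\<dots> = dirderiv h S (dirderiv V S (U S) - dirderiv U S (V S))"
    using dirderiv_linear_direction[OF h S T, of 1 "-1"] by simp
  also have "dirderiv V S (U S) - dirderiv U S (V S) = fisher_connection p S (U S) V - fisher_connection p S (V S) U"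
    by (simp add: fisher_connection_def hadamard_commute[of "V S"])
  finally show "dirderiv (\<lambda>X. dirderiv h X (V X)) S (U S) - dirderiv (\<lambda>X. dirderiv h X (U X)) S (V S)
    = dirderiv h S (fisher_connection p S (U S) V - fisher_connection p S (V S) U)" .
qed

text \<open>
  Differentiating the denominator \<open>S\<^sub>i\<^sub>j\<close> of the metric produces minus the sum of
  \<open>u\<^sub>i\<^sub>j V\<^sub>i\<^sub>j W\<^sub>i\<^sub>j / S\<^sub>i\<^sub>j\<^sup>2\<close>. The Christoffel terms of \<open>V\<close> and \<open>W\<close> contribute one half of it each; the
  projections are invisible to the Fisher product with the tangent vectors \<open>V(S)\<close> and \<open>W(S)\<close>.
\<close>

lemma metric_compatible_fisher:
  assumes pos: "\<forall>i. 0 < p $ i"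
  shows "metric_compatible p (fisher_connection p)"
  unfolding metric_compatible_def
proof (intro allI impI ballI)
  fix V W S u assume V: "vector_field p V" and W: "vector_field p W" and S: "S \<in> manifold p" and u: "u \<in> tangent p"
  let ?V' = "dirderiv V S u" and ?W' = "dirderiv W S u"
  have comp: "((\<lambda>t. Y (S + t *\<^sub>R u) $ i $ j) has_real_derivative dirderiv Y S u $ i $ j) (at 0)"
    if "vector_field p Y" for Y i j
  proof -
    have "bounded_linear (\<lambda>X :: real^'a^'a. X $ i $ j)"
      by (intro bounded_linear_compose[OF bounded_linear_vec_nth] bounded_linear_vec_nth)
    then show ?thesis
      unfolding has_real_derivative_iff_has_vector_derivative
      by (rule bounded_linear.has_vector_derivative)
        (rule smooth_on_manifold_line_derivative[OF vector_fieldD(1)[OF that] S u])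
  qed
  have pt: "S $ i $ j \<noteq> 0" for i j using manifold_pos[OF S, of i j] by simp
  \<comment> \<open>derivative of a summand of the metric, arranged so that the subtracted term is a
    summand of the Fisher product of \<open>(u \<odot> V S) \<oslash> S\<close> with \<open>W S\<close>\<close>
  define d where "d i j = (?V' $ i $ j * W S $ i $ j + V S $ i $ j * ?W' $ i $ j) / S $ i $ j
      - (u $ i $ j * V S $ i $ j / S $ i $ j) * W S $ i $ j / S $ i $ j" for i j
  have "((\<lambda>t. V (S + t *\<^sub>R u) $ i $ j * W (S + t *\<^sub>R u) $ i $ j / (S + t *\<^sub>R u) $ i $ j)
      has_real_derivative d i j) (at 0)" for i j
  proof -
    have "((\<lambda>t. (S + t *\<^sub>R u) $ i $ j) has_real_derivative u $ i $ j) (at 0)"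
      by (auto intro!: derivative_eq_intros)
    from DERIV_divide[OF DERIV_mult[OF comp[OF V] comp[OF W]] this] show ?thesis
      by (rule DERIV_cong) (use pt in \<open>auto simp: d_def field_simps\<close>)
  qed
  then have "((\<lambda>t. fisher (S + t *\<^sub>R u) (V (S + t *\<^sub>R u)) (W (S + t *\<^sub>R u))) has_real_derivative
      (\<Sum>i\<in>UNIV. \<Sum>j\<in>UNIV. d i j)) (at 0)"
    unfolding fisher_def by (intro DERIV_sum)
  then have "dirderiv (\<lambda>X. fisher X (V X) (W X)) S u = (\<Sum>i\<in>UNIV. \<Sum>j\<in>UNIV. d i j)"
    by (intro dirderivI) (simp add: has_real_derivative_iff_has_vector_derivative)
  also have "\<dots> = fisher S ?V' (W S) + fisher S (V S) ?W' - fisher S ((u \<odot> V S) \<oslash> S) (W S)"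
    by (simp add: d_def fisher_def hadamard_def hadamard_div_def sum_subtractf sum.distrib add_divide_distrib)
  also have "fisher S ((u \<odot> V S) \<oslash> S) (W S) = fisher S ((u \<odot> W S) \<oslash> S) (V S)"
    by (simp add: fisher_def hadamard_def hadamard_div_def mult_ac)
  finally have "dirderiv (\<lambda>X. fisher X (V X) (W X)) S u = fisher S ?V' (W S) + fisher S ?W' (V S)
      - (1/2) * fisher S ((u \<odot> V S) \<oslash> S) (W S) - (1/2) * fisher S ((u \<odot> W S) \<oslash> S) (V S)"
    using \<open>fisher S ((u \<odot> V S) \<oslash> S) (W S) = fisher S ((u \<odot> W S) \<oslash> S) (V S)\<close>
    by (simp add: fisher_commute[of S "V S"])
  then show "dirderiv (\<lambda>X. fisher X (V X) (W X)) S u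
      = fisher S (fisher_connection p S u V) (W S) + fisher S (V S) (fisher_connection p S u W)"
    using vector_fieldD(2)[OF V S] vector_fieldD(2)[OF W S]
    by (simp add: fisher_connection_def fisher_diff_left fisher_scaleR_left fisher_projt[OF pos S]
        fisher_commute[of S "V S" "dirderiv W S u - _"])
qed

text \<open>
  Let \<open>T\<close> be the difference of the connections. Then \<open>\<langle>T(X, Y), Z\<rangle>\<close> is symmetric in \<open>X, Y\<close> since both
  are torsion free, and skew in \<open>Y, Z\<close> since both are metric. Alternating these two symmetries three
  times each returns to the start with the opposite sign, so it vanishes for all fields. A tangent
  vector is the value of a constant vector field, so \<open>T(u, V)\<close> itself can be taken for \<open>Z\<close>.
\<close>

lemma levi_civita_unique:
  assumes C: "affine_connection p C" "torsion_free p C" "metric_compatible p C"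
    and C': "affine_connection p C'" "torsion_free p C'" "metric_compatible p C'"
    and S: "S \<in> manifold p" and u: "u \<in> tangent p" and V: "vector_field p V"
  shows "C S u V = C' S u V"
proof -
  define T where "T w W = C S w W - C' S w W" for w W
  have T_tangent: "T w W \<in> tangent p" if "w \<in> tangent p" "vector_field p W" for w W
    using C(1) C'(1) S that unfolding affine_connection_def T_def
    by (intro subspace_diff[OF subspace_tangent]) auto
  have comm: "T (X S) Y = T (Y S) X" if X: "vector_field p X" and Y: "vector_field p Y" for X Y
  proof -
    \<comment> \<open>linear functionals, used as test functions, separate the torsions of the two connections\<close>
    have lin: "dirderiv (\<lambda>Z. Z \<bullet> w) S z = z \<bullet> w" for w z :: "real^'a^'a"
      by (rule dirderivI, unfold has_real_derivative_iff_has_vector_derivative[symmetric] inner_add_left inner_scaleR_left)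
        (auto intro!: derivative_eq_intros)
    have "(C S (X S) Y - C S (Y S) X) \<bullet> w = (C' S (X S) Y - C' S (Y S) X) \<bullet> w" for w
    proof -
      have h: "smooth_on_manifold p (\<lambda>Z. Z \<bullet> w)"
        by (rule smooth_on_manifold_linear[OF bounded_linear_inner_left smooth_on_manifold_ident])
      show ?thesis
        using trans[OF C(2)[unfolded torsion_free_def, rule_format, OF X Y h S, symmetric]
          C'(2)[unfolded torsion_free_def, rule_format, OF X Y h S]]
        by (simp only: lin)
    qed
    then have "C S (X S) Y - C S (Y S) X = C' S (X S) Y - C' S (Y S) X"
      by (simp flip: vector_eq_rdot[of "C S (X S) Y - C S (Y S) X"])
    then have "C S (X S) Y = C' S (X S) Y - C' S (Y S) X + C S (Y S) X"
      by (simp only: diff_eq_eq)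
    then show ?thesis by (simp add: T_def)
  qed
  have anti: "fisher S (T w X) (Y S) = - fisher S (T w Y) (X S)"
    if "w \<in> tangent p" "vector_field p X" "vector_field p Y" for w X Y
  proof -
    have "fisher S (C S w X) (Y S) + fisher S (X S) (C S w Y)
        = fisher S (C' S w X) (Y S) + fisher S (X S) (C' S w Y)"
      using C(3)[unfolded metric_compatible_def, rule_format, OF that(2,3) S that(1)]
        C'(3)[unfolded metric_compatible_def, rule_format, OF that(2,3) S that(1)] by simp
    then show ?thesis
      by (simp add: T_def fisher_diff_left fisher_commute[of S "X S"])
  qed
  have zero: "fisher S (T (X S) Y) (Z S) = 0"
    if X: "vector_field p X" and Y: "vector_field p Y" and Z: "vector_field p Z" for X Y Z
  proof -
    note tan = vector_fieldD(2)[OF _ S]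
    have "fisher S (T (X S) Y) (Z S) = fisher S (T (Y S) X) (Z S)" using comm[OF X Y] by simp
    also have "\<dots> = - fisher S (T (Y S) Z) (X S)" by (rule anti[OF tan[OF Y] X Z])
    also have "\<dots> = - fisher S (T (Z S) Y) (X S)" using comm[OF Y Z] by simp
    also have "\<dots> = fisher S (T (Z S) X) (Y S)" using anti[OF tan[OF Z] Y X] by simp
    also have "\<dots> = fisher S (T (X S) Z) (Y S)" using comm[OF X Z] by simp
    also have "\<dots> = - fisher S (T (X S) Y) (Z S)" by (rule anti[OF tan[OF X] Z Y])
    finally show ?thesis by simp
  qed
  have "fisher S (T u V) (T u V) = 0"
    using zero[OF vector_field_const[OF u] V vector_field_const[OF T_tangent[OF u V]]] by simp
  then have "T u V = 0" using manifold_pos[OF S] by (intro fisher_eq_0_imp)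
  then show ?thesis by (simp add: T_def)
qed

text \<open>
  By existence the chosen connection has the three defining properties, and by uniqueness it then
  coincides with the explicit one.
\<close>

lemma levi_civita_eq_fisher_connection:
  assumes pos: "\<forall>i. 0 < p $ i"
    and "S \<in> manifold p" "u \<in> tangent p" "vector_field p V"
  shows "levi_civita p S u V = fisher_connection p S u V"
proof -
  note F = affine_connection_fisher[OF pos] torsion_free_fisher[of p] metric_compatible_fisher[OF pos]
  have "affine_connection p (levi_civita p) \<and> torsion_free p (levi_civita p) \<and> metric_compatible p (levi_civita p)"
    unfolding levi_civita_def by (rule someI[of _ "fisher_connection p"]) (intro conjI F)
  then show ?thesis by (elim conjE) (rule levi_civita_unique[OF _ _ _ F assms(2-4)])
qed

section \<open>The Riemannian gradient and its derivative\<close>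

lemma Grad_eq:
  assumes "smooth_on U F" "x \<in> U"
  shows "Grad F x = (\<Sum>b\<in>Basis. frechet_derivative F (at x) b *\<^sub>R b)" (is "_ = ?g")
    and frechet_derivative_eq_inner_Grad: "frechet_derivative F (at x) v = v \<bullet> Grad F x"
proof -
  have D: "(F has_derivative frechet_derivative F (at x)) (at x)"
    by (rule smooth_on_has_derivative[OF assms])
  have inner: "frechet_derivative F (at x) h = h \<bullet> ?g" for h
    using linear_Basis_expansion[OF has_derivative_linear[OF D], of h]
    by (simp add: inner_sum_right mult.commute)
  have G: "GDERIV F x :> ?g"
    unfolding gderiv_def using D by (simp add: inner[abs_def, symmetric])
  show g: "Grad F x = ?g"
    unfolding Grad_def
  proof (rule the_equality)
    show "GDERIV F x :> ?g" by (rule G)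
  next
    fix D assume "GDERIV F x :> D"
    then have "(\<lambda>h. h \<bullet> D) = (\<lambda>h. h \<bullet> ?g)"
      using G unfolding gderiv_def by (rule has_derivative_unique)
    then have "\<forall>h. h \<bullet> D = h \<bullet> ?g" by (simp add: fun_eq_iff)
    then show "D = ?g" by (rule vector_eq_ldot[THEN iffD1])
  qed
  show "frechet_derivative F (at x) v = v \<bullet> Grad F x" unfolding g by (rule inner)
qed

lemma smooth_on_Grad:
  assumes "open U" "smooth_on U F"
  shows "smooth_on U (Grad F)"
proof (rule smooth_on_transform[OF \<open>open U\<close>])
  show "smooth_on U (\<lambda>x. \<Sum>b\<in>Basis. frechet_derivative F (at x) b *\<^sub>R b)"
    by (intro smooth_on_sum smooth_on_scaleR smooth_on_frechet_derivative[OF assms(2)] smooth_on_const assms(1))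
  show "(\<Sum>b\<in>Basis. frechet_derivative F (at x) b *\<^sub>R b) = Grad F x" if "x \<in> U" for x
    by (rule Grad_eq[OF assms(2) that, symmetric])
qed

context
  fixes p :: "real^'n" and f F :: "real^'n^'n \<Rightarrow> real" and U
  assumes pos: "\<forall>i. 0 < p $ i"
    and U: "open U" "manifold p \<subseteq> U" and F: "smooth_on U F" and fF: "\<forall>X\<in>manifold p. F X = f X"
begin

text \<open>
  Multiplication by \<open>S\<close> turns the Frobenius product into the Fisher product, so
  \<open>Grad F(S) \<odot> S\<close> represents the differential on all symmetric directions, and its projection
  represents it on the tangent space.
\<close>

lemma rgrad_eq_projt:
  assumes S: "S \<in> manifold p"
  shows "rgrad p f S = projt p S (Grad F S \<odot> S)"
proof -
  have D: "fisher S (projt p S (Grad F S \<odot> S)) \<eta> = dirderiv f S \<eta>" if \<eta>: "\<eta> \<in> tangent p" for \<eta>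
  proof -
    have "dirderiv f S \<eta> = frechet_derivative F (at S) \<eta>"
      using fF by (intro extension_dirderiv[OF F U(2) _ S \<eta>]) auto
    also have "\<dots> = \<eta> \<bullet> Grad F S"
      using S U(2) by (intro frechet_derivative_eq_inner_Grad[OF F]) auto
    also have "\<dots> = fisher S (Grad F S \<odot> S) \<eta>"
      using manifold_pos[OF S]
      by (simp add: inner_vec_def fisher_def hadamard_def less_imp_neq[symmetric] mult.commute)
    finally show ?thesis by (simp add: fisher_projt[OF pos S \<eta>])
  qed
  show ?thesis
    unfolding rgrad_def
  proof (rule the_equality)
    show "projt p S (Grad F S \<odot> S) \<in> tangent p \<and>
        (\<forall>\<eta>\<in>tangent p. fisher S (projt p S (Grad F S \<odot> S)) \<eta> = dirderiv f S \<eta>)"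
      using D projt_in_tangent[OF pos S] by blast
  next
    fix G assume G: "G \<in> tangent p \<and> (\<forall>\<eta>\<in>tangent p. fisher S G \<eta> = dirderiv f S \<eta>)"
    let ?d = "G - projt p S (Grad F S \<odot> S)"
    have d: "?d \<in> tangent p"
      using G by (intro subspace_diff[OF subspace_tangent] projt_in_tangent[OF pos S]) auto
    then have "fisher S ?d ?d = 0" using G D by (simp add: fisher_diff_left)
    then have "?d = 0" using manifold_pos[OF S] by (intro fisher_eq_0_imp)
    then show "G = projt p S (Grad F S \<odot> S)" by simp
  qed
qed

lemma smooth_on_manifold_Grad_hadamard: "smooth_on_manifold p (\<lambda>S. Grad F S \<odot> S)"
  by (rule smooth_on_manifold_bilinear[OF bounded_bilinear_hadamard _ smooth_on_manifold_ident])
    (rule smooth_on_manifoldI[OF U smooth_on_Grad[OF U(1) F]], simp)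

lemma vector_field_rgrad: "vector_field p (rgrad p f)"
  unfolding vector_field_def
  using smooth_on_manifold_transform[OF smooth_on_manifold_projt[OF pos smooth_on_manifold_Grad_hadamard]]
    rgrad_eq_projt projt_in_tangent[OF pos] by simp

lemma rhess_eq:
  assumes S: "S \<in> manifold p" and \<xi>: "\<xi> \<in> tangent p"
  shows "rhess p f S \<xi> = projt p S (dirderiv (rgrad p f) S \<xi>)
    - (1/2) *\<^sub>R projt p S ((projt p S (Grad F S \<odot> S) \<odot> \<xi>) \<oslash> S)"
  unfolding rhess_def levi_civita_eq_fisher_connection[OF pos S \<xi> vector_field_rgrad]
    fisher_connection_def rgrad_eq_projt[OF S]
    projt_tangent_id[OF S dirderiv_vector_field_tangent[OF vector_field_rgrad S \<xi>]]
  by (simp add: hadamard_commute)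

text \<open>
  The multiplier \<open>a(X)\<close> of \<open>Grad F(X) \<odot> X\<close> is smooth along the manifold. Differentiating the
  system that it satisfies, whose matrix is linear in \<open>X\<close>, shows that its derivative solves the same
  system as \<open>\<alpha>'\<close>; injectivity of the matrix identifies the two.
\<close>

lemma rgrad_derivative:
  assumes S: "S \<in> manifold p" and \<xi>: "\<xi> \<in> tangent p"
  defines "q \<equiv> sqrt_vec p" and "\<gamma>' \<equiv> Hess F S \<xi> \<odot> S + Grad F S \<odot> \<xi>"
  assumes \<alpha>: "sys_mat p S *v \<alpha> = sym_part (Grad F S \<odot> S) *v q"
    and \<alpha>': "sys_mat p S *v \<alpha>' = sym_part \<gamma>' *v q - sys_mat p \<xi> *v \<alpha>"
  shows "((\<lambda>t. rgrad p f (S + t *\<^sub>R \<xi>)) has_vector_derivative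
    sym_part \<gamma>' - ((outer \<alpha>' q + outer q \<alpha>') \<odot> S + (outer \<alpha> q + outer q \<alpha>) \<odot> \<xi>)) (at 0)"
proof -
  define a where "a X = multiplier p X (Grad F X \<odot> X)" for X
  have a_eq: "sys_mat p X *v a X = sym_part (Grad F X \<odot> X) *v q" if "X \<in> manifold p" for X
    unfolding a_def q_def by (rule sys_mat_multiplier[OF pos that])
  have aS: "a S = \<alpha>"
    using a_eq[OF S] \<alpha> cramer_solution_iff[OF invertible_sys_mat[OF pos S]] by metis
  have lin_sym: "bounded_linear (sym_part :: real^'n^'n \<Rightarrow> _)" and lin_sys: "bounded_linear (sys_mat p)"
    by (simp_all add: linear_sym_part linear_sys_mat flip: linear_conv_bounded_linear)
  have line: "((\<lambda>t. S + t *\<^sub>R \<xi>) has_vector_derivative \<xi>) (at 0)"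
    by (auto intro!: derivative_eq_intros)
  have "S \<in> U" using S U(2) by blast
  then have "((\<lambda>t. Grad F (S + t *\<^sub>R \<xi>)) has_vector_derivative Hess F S \<xi>) (at 0)"
    unfolding Hess_def
    using dirderivI[OF smooth_on_line_derivative[OF smooth_on_Grad[OF U(1) F]]]
      smooth_on_line_derivative[OF smooth_on_Grad[OF U(1) F]] by simp
  from bounded_bilinear.has_vector_derivative[OF bounded_bilinear_hadamard this line]
  have \<gamma>: "((\<lambda>t. Grad F (S + t *\<^sub>R \<xi>) \<odot> (S + t *\<^sub>R \<xi>)) has_vector_derivative \<gamma>') (at 0)"
    by (simp add: \<gamma>'_def add.commute)
  note sym\<gamma> = bounded_linear.has_vector_derivative[OF lin_sym \<gamma>]
  have a: "((\<lambda>t. a (S + t *\<^sub>R \<xi>)) has_vector_derivative dirderiv a S \<xi>) (at 0)"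
    unfolding a_def
    by (rule smooth_on_manifold_line_derivative[OF smooth_on_manifold_multiplier[OF pos
      smooth_on_manifold_Grad_hadamard] S \<xi>])
  have "((\<lambda>t. sys_mat p (S + t *\<^sub>R \<xi>) *v a (S + t *\<^sub>R \<xi>)) has_vector_derivative
      sys_mat p S *v dirderiv a S \<xi> + sys_mat p \<xi> *v \<alpha>) (at 0)"
    using bounded_bilinear.has_vector_derivative[OF bounded_bilinear_matrix_vector
      bounded_linear.has_vector_derivative[OF lin_sys line] a] by (simp add: aS)
  moreover have "((\<lambda>t. sys_mat p (S + t *\<^sub>R \<xi>) *v a (S + t *\<^sub>R \<xi>)) has_vector_derivative
      sym_part \<gamma>' *v q) (at 0)"
    by (rule manifold_line_transform[OF S \<xi>, where H = "\<lambda>X. sym_part (Grad F X \<odot> X) *v q" and h = "\<lambda>X. sys_mat p X *v a X"])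
      (simp_all add: a_eq bounded_linear.has_vector_derivative[OF
        bounded_bilinear.bounded_linear_left[OF bounded_bilinear_matrix_vector] sym\<gamma>])
  ultimately have "sys_mat p S *v dirderiv a S \<xi> + sys_mat p \<xi> *v \<alpha> = sym_part \<gamma>' *v q"
    by (rule vector_derivative_unique_at)
  then have "sys_mat p S *v dirderiv a S \<xi> = sys_mat p S *v \<alpha>'"
    by (simp add: \<alpha>' eq_diff_eq)
  then have "dirderiv a S \<xi> = \<alpha>'"
    using cramer_solution_iff[OF invertible_sys_mat[OF pos S]] by metis
  with a have a': "((\<lambda>t. a (S + t *\<^sub>R \<xi>)) has_vector_derivative \<alpha>') (at 0)" by simp
  have N: "((\<lambda>t. normal_part q (S + t *\<^sub>R \<xi>) (a (S + t *\<^sub>R \<xi>))) has_vector_derivative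
      (outer \<alpha> q + outer q \<alpha>) \<odot> \<xi> + (outer \<alpha>' q + outer q \<alpha>') \<odot> S) (at 0)"
    unfolding normal_part_def
    using bounded_bilinear.has_vector_derivative[OF bounded_bilinear_hadamard
      has_vector_derivative_add[OF
        bounded_linear.has_vector_derivative[OF bounded_bilinear.bounded_linear_left[OF bounded_bilinear_outer] a']
        bounded_linear.has_vector_derivative[OF bounded_bilinear.bounded_linear_right[OF bounded_bilinear_outer] a']]
      line] by (simp add: aS)
  show ?thesis
  proof (rule manifold_line_transform[OF S \<xi>])
    show "sym_part (Grad F X \<odot> X) - normal_part q X (a X) = rgrad p f X" if "X \<in> manifold p" for X
      unfolding rgrad_eq_projt[OF that] projt_formula[OF pos that] a_def q_def ..
    show "((\<lambda>t. sym_part (Grad F (S + t *\<^sub>R \<xi>) \<odot> (S + t *\<^sub>R \<xi>))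
        - normal_part q (S + t *\<^sub>R \<xi>) (a (S + t *\<^sub>R \<xi>))) has_vector_derivative
      sym_part \<gamma>' - ((outer \<alpha>' q + outer q \<alpha>') \<odot> S + (outer \<alpha> q + outer q \<alpha>) \<odot> \<xi>)) (at 0)"
      using has_vector_derivative_diff[OF sym\<gamma> N] by (simp add: add.commute)
  qed
qed

end

theorem lemma4:
  fixes p :: "real^'n"
    and f F :: "real^'n^'n \<Rightarrow> real"
    and U :: "(real^'n^'n) set"
    and S \<xi> :: "real^'n^'n"
  assumes "probability_vector p"
    and "\<forall>i. 0 < p $ i"
    and "open U" and "manifold p \<subseteq> U" and "smooth_on U F"
    and "\<forall>X\<in>manifold p. F X = f X"
    and "S \<in> manifold p" and "\<xi> \<in> tangent p"
  shows
    "let q = sqrt_vec p;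
         \<gamma> = Grad F S \<odot> S;
         \<gamma>' = Hess F S \<xi> \<odot> S + Grad F S \<odot> \<xi>;
         correction = (1/2) *\<^sub>R projt p S ((projt p S (Grad F S \<odot> S) \<odot> \<xi>) \<oslash> S)
     in
       rhess p f S \<xi> = projt p S (dirderiv (rgrad p f) S \<xi>) - correction \<and>
       invertible (sys_mat p S) \<and>
       (\<forall>\<alpha> \<alpha>'.
          sys_mat p S *v \<alpha> = sym_part \<gamma> *v q \<longrightarrow>
          sys_mat p S *v \<alpha>' = sym_part \<gamma>' *v q
            - (diag ((\<xi> ** diag q) *v q) + diag q ** \<xi> ** diag q) *v \<alpha> \<longrightarrow>
          (let R = \<gamma>' - (outer \<alpha>' q + outer q \<alpha>') \<odot> S - (outer \<alpha> q + outer q \<alpha>) \<odot> \<xi>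
           in
             ((\<lambda>t. rgrad p f (S + t *\<^sub>R \<xi>)) has_vector_derivative sym_part R) (at 0) \<and>
             (transpose \<gamma>' = \<gamma>' \<longrightarrow> dirderiv (rgrad p f) S \<xi> = R) \<and>
             rhess p f S \<xi> = projt p S R - correction))"
proof -
  note pos = assms(2) and ext = assms(3-6) and S = assms(7) and \<xi> = assms(8)
  let ?q = "sqrt_vec p"
  let ?\<gamma>' = "Hess F S \<xi> \<odot> S + Grad F S \<odot> \<xi>"
  let ?corr = "(1/2) *\<^sub>R projt p S ((projt p S (Grad F S \<odot> S) \<odot> \<xi>) \<oslash> S)"
  have hess: "rhess p f S \<xi> = projt p S (dirderiv (rgrad p f) S \<xi>) - ?corr"
    by (rule rhess_eq[OF pos ext S \<xi>])
  have derivative: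
    "((\<lambda>t. rgrad p f (S + t *\<^sub>R \<xi>)) has_vector_derivative sym_part R) (at 0) \<and>
     (transpose ?\<gamma>' = ?\<gamma>' \<longrightarrow> dirderiv (rgrad p f) S \<xi> = R) \<and>
     rhess p f S \<xi> = projt p S R - ?corr"
    if \<alpha>: "sys_mat p S *v \<alpha> = sym_part (Grad F S \<odot> S) *v ?q"
      and \<alpha>': "sys_mat p S *v \<alpha>' = sym_part ?\<gamma>' *v ?q
        - (diag ((\<xi> ** diag ?q) *v ?q) + diag ?q ** \<xi> ** diag ?q) *v \<alpha>"
      and R: "R = ?\<gamma>' - (outer \<alpha>' ?q + outer ?q \<alpha>') \<odot> S - (outer \<alpha> ?q + outer ?q \<alpha>) \<odot> \<xi>"
    for \<alpha> \<alpha>' R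
  proof -
    let ?N = "(outer \<alpha>' ?q + outer ?q \<alpha>') \<odot> S + (outer \<alpha> ?q + outer ?q \<alpha>) \<odot> \<xi>"
    \<comment> \<open>the normal terms are symmetric, so symmetrizing \<open>R\<close> affects \<open>\<gamma>'\<close> only\<close>
    have "transpose ?N = ?N"
      using manifold_nth_commute[OF S] tangent_nth_commute[OF \<xi>]
      by (simp add: vec_eq_iff transpose_def hadamard_def outer_def mult_ac add.commute)
    then have symN: "sym_part ?N = ?N" by (rule sym_part_id)
    have R': "R = ?\<gamma>' - ?N" unfolding R by simp
    have symR: "sym_part R = sym_part ?\<gamma>' - ?N"
      unfolding R' linear_diff[OF linear_sym_part] symN ..
    have sys\<xi>: "sys_mat p \<xi> = diag ((\<xi> ** diag ?q) *v ?q) + diag ?q ** \<xi> ** diag ?q"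
      by (simp only: sys_mat_def Let_def)
    have D: "((\<lambda>t. rgrad p f (S + t *\<^sub>R \<xi>)) has_vector_derivative sym_part R) (at 0)"
      unfolding symR
      by (rule rgrad_derivative[OF pos ext S \<xi> \<alpha> \<alpha>'[folded sys\<xi>]])
    then have dd: "dirderiv (rgrad p f) S \<xi> = sym_part R" by (rule dirderivI)
    have "dirderiv (rgrad p f) S \<xi> = R" if "transpose ?\<gamma>' = ?\<gamma>'"
      using dd symR sym_part_id[OF that] R' by simp
    moreover have "rhess p f S \<xi> = projt p S R - ?corr"
      using hess unfolding dd projt_sym_part .
    ultimately show ?thesis using D by blast
  qed
  show ?thesis
    unfolding Let_def
    using hess invertible_sys_mat[OF pos S] derivative[OF _ _ refl] by blast
qed

end
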